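(* Let $X$ be an $\omega$-narrow Čech-complete topological group and $Y$ be any topological group. Every BP-measurable homomorphism $h:X\to Y$ is continuous.
   Context: A topological group $X$ is $\omega$-narrow if for every nonempty open set $U\subseteq X$ there is a countable set $C\subseteq X$ with $X=CU=UC$. A Tychonoff space is Čech-complete if it is homeomorphic to a $G_\delta$-subset of some compact Hausdorff space. The $\sigma$-algebra of sets with the Baire Property in a space $X$ is the smallest $\sigma$-algebra containing all open and all meager subsets of $X$. A function $f:X\to Y$ is BP-measurable if for every open $U\subseteq Y$ the preimage $f^{-1}[U]$ has the Baire Property in $X$. *)

theory Defs
  imports "HOL-Analysis.Analysis" "HOL-Algebra.Algebra"
begin

definition topological_group :: "('a, 'b) monoid_scheme \<Rightarrow> 'a topology \<Rightarrow> bool" where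
  "topological_group G T \<longleftrightarrow> group G \<and> topspace T = carrier G \<and>
     continuous_map (prod_topology T T) T (\<lambda>(x, y). x \<otimes>\<^bsub>G\<^esub> y) \<and>
     continuous_map T T (\<lambda>x. inv\<^bsub>G\<^esub> x)"

definition omega_narrow :: "('a, 'b) monoid_scheme \<Rightarrow> 'a topology \<Rightarrow> bool" where
  "omega_narrow G T \<longleftrightarrow> (\<forall>U. openin T U \<and> U \<noteq> {} \<longrightarrow>
     (\<exists>C. countable C \<and> C \<subseteq> carrier G \<and>
          carrier G = C <#>\<^bsub>G\<^esub> U \<and> carrier G = U <#>\<^bsub>G\<^esub> C))"

text \<open>Cech-completeness: Tychonoff and homeomorphic to a G_delta subset of some compact
  Hausdorff space. The compact space lives on a type 'k given by the itself-argument;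
  in the theorem 'k is a free (hence arbitrary) type variable.\<close>
definition cech_complete :: "'k itself \<Rightarrow> 'a topology \<Rightarrow> bool" where
  "cech_complete (t :: 'k itself) T \<longleftrightarrow>
     completely_regular_space T \<and> Hausdorff_space T \<and>
     (\<exists>(K :: 'k topology) f. compact_space K \<and> Hausdorff_space K \<and>
        f ` topspace T \<subseteq> topspace K \<and> gdelta_in K (f ` topspace T) \<and>
        homeomorphic_map T (subtopology K (f ` topspace T)) f)"

definition nowhere_dense_in :: "'a topology \<Rightarrow> 'a set \<Rightarrow> bool" where
  "nowhere_dense_in T S \<longleftrightarrow> S \<subseteq> topspace T \<and> T interior_of (T closure_of S) = {}"

definition meager_in :: "'a topology \<Rightarrow> 'a set \<Rightarrow> bool" where
  "meager_in T S \<longleftrightarrow> (countable union_of nowhere_dense_in T) S"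

definition baire_property_sets :: "'a topology \<Rightarrow> 'a set set" where
  "baire_property_sets T = sigma_sets (topspace T) {S. openin T S \<or> meager_in T S}"

definition BP_measurable :: "'a topology \<Rightarrow> 'c topology \<Rightarrow> ('a \<Rightarrow> 'c) \<Rightarrow> bool" where
  "BP_measurable T Y f \<longleftrightarrow>
     (\<forall>U. openin Y U \<longrightarrow> {x \<in> topspace T. f x \<in> U} \<in> baire_property_sets T)"

end

theory Submission
  imports Defs
begin

text \<open>Let \<open>W\<close> be a neighbourhood of the identity of \<open>Y\<close>. If the preimage \<open>A\<close> of \<open>W\<close> is nonmeager, Pettis'
  argument shows that \<open>A\<^sup>-\<^sup>1 A\<close> is a neighbourhood of the identity. So the point is to exclude that \<open>A\<close>
  is meager although \<open>Y\<close> need not be narrow.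

  Suppose that \<open>A\<close> is meager, hence disjoint from an intersection of dense open sets \<open>D\<^sub>m\<close>. A countable
  closing-off argument yields a compact normal subgroup \<open>K\<close> with a countable neighbourhood base such
  that the largest K-invariant subset of each \<open>D\<^sub>m\<close> is still open and dense. Then \<open>A K\<close> is meager too,
  and by narrowness \<open>X/K\<close> has at most continuum many points. Pulling back the uniformity of \<open>Y\<close> modulo
  \<open>h(K)\<close> and refining a cover by translates of \<open>A K\<close> as in Stone's theorem gives a function \<open>f\<close> from a
  nonmeager set to the Cantor space, with meager fibres, such that every preimage has the Baire
  property. Let \<open>B\<close> be a Bernstein set. The preimage of \<open>B\<close> or of its complement is
  comeager in some nonempty open set, where \<open>f\<close> is continuous on a comeager set; a Cantor scheme
  then produces a perfect set inside \<open>B\<close> or inside its complement, a contradiction.\<close>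

section \<open>Meager sets and the Baire property\<close>

lemma openin_subset_closure_of: "openin T U \<Longrightarrow> U \<subseteq> T closure_of U"
  by (intro closure_of_subset openin_subset)

lemma nowhere_dense_in_subset:
  "nowhere_dense_in T S \<Longrightarrow> R \<subseteq> S \<Longrightarrow> nowhere_dense_in T R"
  unfolding nowhere_dense_in_def
  by (metis closure_of_mono interior_of_mono subset_empty subset_trans)

lemma meager_in_subset_topspace: "meager_in T S \<Longrightarrow> S \<subseteq> topspace T"
  unfolding meager_in_def union_of_def nowhere_dense_in_def by auto

lemma meager_in_nowhere_dense: "nowhere_dense_in T S \<Longrightarrow> meager_in T S"
  unfolding meager_in_def by (rule countable_union_of_inc)

lemma meager_in_subset:
  assumes "meager_in T S" "R \<subseteq> S" shows "meager_in T R"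
proof -
  obtain U where U: "countable U" "U \<subseteq> Collect (nowhere_dense_in T)" "\<Union>U = S"
    using assms(1) by (auto simp: meager_in_def union_of_def)
  have "countable ((\<lambda>N. N \<inter> R) ` U)" "(\<lambda>N. N \<inter> R) ` U \<subseteq> Collect (nowhere_dense_in T)"
    using U by (auto intro: nowhere_dense_in_subset)
  moreover have "\<Union>((\<lambda>N. N \<inter> R) ` U) = R" using U assms(2) by auto
  ultimately show ?thesis unfolding meager_in_def union_of_def by blast
qed

lemma meager_in_Union:
  assumes "countable \<M>" "\<And>M. M \<in> \<M> \<Longrightarrow> meager_in T M" shows "meager_in T (\<Union>\<M>)"
  using assms unfolding meager_in_def by (rule countable_union_of_Union)

lemma meager_in_Un: "meager_in T R \<Longrightarrow> meager_in T S \<Longrightarrow> meager_in T (R \<union> S)"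
  unfolding meager_in_def by (rule countable_union_of_Un)

lemma meager_in_empty: "meager_in T {}"
  by (rule meager_in_nowhere_dense) (simp add: nowhere_dense_in_def)

definition dense_open :: "'a topology \<Rightarrow> 'a set \<Rightarrow> bool" where
  "dense_open T U \<longleftrightarrow> openin T U \<and> (\<forall>V. openin T V \<and> V \<noteq> {} \<longrightarrow> U \<inter> V \<noteq> {})"

lemma dense_open_closure: "dense_open T U \<longleftrightarrow> openin T U \<and> T closure_of U = topspace T"
  unfolding dense_open_def dense_intersects_open by blast

lemma nowhere_dense_complement:
  assumes "nowhere_dense_in T N" shows "dense_open T (topspace T - T closure_of N)"
  using assms unfolding dense_open_closure nowhere_dense_in_def
  by (simp add: closure_of_complement openin_diff)

lemma dense_open_complement:
  assumes "dense_open T U" shows "nowhere_dense_in T (topspace T - U)"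
  using assms unfolding dense_open_closure nowhere_dense_in_def
  by (simp add: closure_of_complement interior_of_complement interior_of_openin)

text \<open>Complements of closures turn nowhere dense pieces into dense open sets, and complements
  of dense open sets are nowhere dense. Category arguments below mostly start from this form,
  because open sets can be shrunk into each \<open>G n\<close> in turn.\<close>

lemma meager_in_iff:
  "meager_in T S \<longleftrightarrow> S \<subseteq> topspace T \<and> (\<exists>G. (\<forall>n::nat. dense_open T (G n)) \<and> S \<inter> (\<Inter>n. G n) = {})"
proof (intro iffI conjI)
  assume m: "meager_in T S"
  then show "S \<subseteq> topspace T" by (rule meager_in_subset_topspace)
  obtain U where U: "countable U" "U \<subseteq> Collect (nowhere_dense_in T)" "\<Union>U = S"
    using m by (auto simp: meager_in_def union_of_def)
  \<comment> \<open>Inserting the empty set keeps the family nonempty, so that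
    \<open>from_nat_into\<close> enumerates exactly this family even when \<open>U\<close> is
    empty.\<close>
  define N where "N n = from_nat_into (insert {} U) n" for n
  have rN: "range N = insert {} U"
    unfolding N_def using U(1) by (intro range_from_nat_into) auto
  then have N: "nowhere_dense_in T (N n)" for n
  proof -
    have "N n \<in> insert {} U" unfolding rN[symmetric] by simp
    then consider "N n = {}" | "N n \<in> U" by blast
    then show ?thesis
    proof cases
      case 1 then show ?thesis unfolding nowhere_dense_in_def by simp
    next
      case 2 then show ?thesis using U(2) by (metis mem_Collect_eq subsetD)
    qed
  qed
  have S: "S = (\<Union>n. N n)" unfolding rN U(3)[symmetric] by simp
  have "S \<inter> (\<Inter>n. topspace T - T closure_of N n) = {}"
  proof -
    have "N n \<subseteq> T closure_of N n" for n
      by (rule closure_of_subset) (use N[of n] in \<open>simp add: nowhere_dense_in_def\<close>)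
    then show ?thesis unfolding S by blast
  qed
  then show "\<exists>G. (\<forall>n::nat. dense_open T (G n)) \<and> S \<inter> (\<Inter>n. G n) = {}"
    using nowhere_dense_complement[OF N] by (intro exI[of _ "\<lambda>n. topspace T - T closure_of N n"]) auto
next
  assume a: "S \<subseteq> topspace T \<and> (\<exists>G. (\<forall>n::nat. dense_open T (G n)) \<and> S \<inter> (\<Inter>n. G n) = {})"
  then obtain G where G: "\<And>n::nat. dense_open T (G n)" "S \<inter> (\<Inter>n. G n) = {}" by blast
  have "meager_in T (\<Union>n. topspace T - G n)"
  proof (rule meager_in_Union)
    fix M assume "M \<in> range (\<lambda>n. topspace T - G n)"
    then show "meager_in T M" using G(1) dense_open_complement meager_in_nowhere_dense by fastforce
  qed simp
  moreover have "S \<subseteq> (\<Union>n. topspace T - G n)" using a G(2) by auto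
  ultimately show "meager_in T S" by (rule meager_in_subset)
qed

lemma meager_inE:
  assumes "meager_in T S"
  obtains G where "\<And>n::nat. dense_open T (G n)" "S \<inter> (\<Inter>n. G n) = {}"
  using assms unfolding meager_in_iff by blast

text \<open>Sets that differ from an open set by a meager set include the generators and are closed
  under complements and countable unions, hence exhaust the generated sigma-algebra.\<close>

lemma baire_property_setsD:
  assumes "S \<in> baire_property_sets T"
  shows "S \<subseteq> topspace T \<and> (\<exists>U. openin T U \<and> meager_in T (S - U) \<and> meager_in T (U - S))"
  using assms unfolding baire_property_sets_def
proof (induction rule: sigma_sets.induct)
  case (Basic S)
  show ?case
  proof (cases "openin T S")
    case True then show ?thesis using meager_in_empty by (metis Diff_cancel openin_subset)
  next
    case False
    then have "meager_in T S" using Basic by auto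
    then show ?thesis using meager_in_empty
      by (metis Diff_empty empty_Diff meager_in_subset_topspace openin_empty)
  qed
next
  case Empty then show ?case using meager_in_empty by (metis Diff_empty empty_subsetI openin_empty)
next
  case (Compl S)
  then obtain U where U: "openin T U" "meager_in T (S - U)" "meager_in T (U - S)" by blast
  \<comment> \<open>The complement of \<open>U\<close> need not be open, but it exceeds its interior
    only by the boundary of \<open>U\<close>, which is nowhere dense.\<close>
  let ?V = "T interior_of (topspace T - U)"
  have "dense_open T (U \<union> ?V)"
    unfolding dense_open_def
  proof (intro conjI allI impI)
    fix V assume V: "openin T V \<and> V \<noteq> {}"
    show "(U \<union> ?V) \<inter> V \<noteq> {}"
    proof
      assume e: "(U \<union> ?V) \<inter> V = {}"
      then have "V \<subseteq> topspace T - U" using V openin_subset by fastforce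
      then have "V \<subseteq> ?V" using V by (simp add: interior_of_maximal)
      then show False using e V by blast
    qed
  qed (use U in auto)
  then have "meager_in T (topspace T - (U \<union> ?V))"
    by (intro meager_in_nowhere_dense dense_open_complement)
  then have "meager_in T ((topspace T - (U \<union> ?V)) \<union> (U - S))"
    using U(3) by (rule meager_in_Un)
  then have "meager_in T ((topspace T - S) - ?V)" by (rule meager_in_subset) blast
  moreover have "?V - (topspace T - S) \<subseteq> S - U"
    using interior_of_subset[of T "topspace T - U"] by blast
  then have "meager_in T (?V - (topspace T - S))" by (rule meager_in_subset[OF U(2)])
  ultimately show ?case by (intro conjI Diff_subset exI[of _ ?V] openin_interior_of)
next
  case (Union S)
  then obtain U where U: "\<And>i::nat. openin T (U i) \<and> meager_in T (S i - U i) \<and> meager_in T (U i - S i)"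
    by metis
  have 1: "meager_in T (\<Union>i. S i - U i)" "meager_in T (\<Union>i. U i - S i)"
    using U by (intro meager_in_Union; fastforce)+
  have "openin T (\<Union>i. U i)" using U by (intro openin_Union) auto
  moreover have "meager_in T ((\<Union>i. S i) - (\<Union>i. U i))" by (rule meager_in_subset[OF 1(1)]) blast
  moreover have "meager_in T ((\<Union>i. U i) - (\<Union>i. S i))" by (rule meager_in_subset[OF 1(2)]) blast
  moreover have "(\<Union>i. S i) \<subseteq> topspace T" using Union by (simp add: UN_subset_iff)
  ultimately show ?case by (intro conjI exI[of _ "\<Union>i. U i"])
qed

section \<open>Complete sequences of open covers\<close>

text \<open>Frolik's internal form of Cech-completeness; it makes the compactification disappear from the
  rest of the argument.\<close>

definition complete_seq :: "'a topology \<Rightarrow> (nat \<Rightarrow> 'a set set) \<Rightarrow> bool" where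
  "complete_seq T \<C> \<longleftrightarrow>
     (\<forall>n. (\<forall>U\<in>\<C> n. openin T U) \<and> \<Union>(\<C> n) = topspace T) \<and>
     (\<forall>\<F>. (\<forall>F\<in>\<F>. closedin T F \<and> F \<noteq> {}) \<and> (\<forall>E\<in>\<F>. \<forall>F\<in>\<F>. \<exists>D\<in>\<F>. D \<subseteq> E \<inter> F) \<and>
          (\<forall>n. \<exists>F\<in>\<F>. \<exists>U\<in>\<C> n. F \<subseteq> U) \<longrightarrow> \<Inter>\<F> \<noteq> {})"

lemma filter_base_finite_Inter:
  assumes "finite \<E>" "\<E> \<noteq> {}" "\<E> \<subseteq> \<F>" "\<And>E F. E \<in> \<F> \<Longrightarrow> F \<in> \<F> \<Longrightarrow> \<exists>D\<in>\<F>. D \<subseteq> E \<inter> F"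
  shows "\<exists>D\<in>\<F>. D \<subseteq> \<Inter>\<E>"
  using assms(1-3)
proof (induction rule: finite_ne_induct)
  case (singleton x) then show ?case by auto
next
  case (insert x \<E>)
  then obtain D where "D \<in> \<F>" "D \<subseteq> \<Inter>\<E>" by auto
  then obtain D' where "D' \<in> \<F>" "D' \<subseteq> x \<inter> D" using assms(4)[of x D] insert.prems by auto
  then show ?case using \<open>D \<subseteq> _\<close> by (intro bexI[of _ D']) auto
qed

text \<open>With the image of the space written as the intersection of open sets \<open>O' n\<close>
  of the compact \<open>K\<close>, cover \<open>n\<close> consists of the open sets whose closure in
  \<open>K\<close> stays inside \<open>O' n\<close>. Compactness gives a point common to the
  closures of the members of a filter base; smallness puts it in every \<open>O' n\<close>, hence in
  the image, and relative closedness puts its preimage in every member.\<close>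

lemma cech_complete_imp_complete_seq:
  assumes "cech_complete TYPE('k) T"
  shows "\<exists>\<C>. complete_seq T \<C>"
proof -
  obtain K :: "'k topology" and f where K: "compact_space K" "Hausdorff_space K"
    and fK: "f ` topspace T \<subseteq> topspace K" and gd: "gdelta_in K (f ` topspace T)"
    and hom: "homeomorphic_map T (subtopology K (f ` topspace T)) f"
    using assms unfolding cech_complete_def by blast
  let ?X = "f ` topspace T"
  obtain O' where O': "\<And>n::nat. openin K (O' n)" "\<Inter>(range O') = ?X"
    using gd unfolding gdelta_in_descending by blast
  have reg: "regular_space K" using K compact_Hausdorff_imp_regular_space by blast
  have inj: "inj_on f (topspace T)" using hom homeomorphic_imp_injective_map by blast
  have cont: "continuous_map T K f"
    using hom homeomorphic_imp_continuous_map continuous_map_into_fulltopology by blast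
  define \<C> where "\<C> n = {U. openin T U \<and> K closure_of (f ` U) \<subseteq> O' n}" for n
  have "\<Union>(\<C> n) = topspace T" for n
  proof
    show "\<Union>(\<C> n) \<subseteq> topspace T" unfolding \<C>_def by (auto dest: openin_subset)
    show "topspace T \<subseteq> \<Union>(\<C> n)"
    proof
      fix x assume x: "x \<in> topspace T"
      have "f x \<in> O' n" using x O'(2) by blast
      then have "closedin K (topspace K - O' n)" "f x \<in> topspace K - (topspace K - O' n)"
        using O'(1) fK x by auto
      then obtain U where U: "openin K U" "f x \<in> U" "disjnt (topspace K - O' n) (K closure_of U)"
        using reg unfolding regular_space by blast
      define V where "V = {y \<in> topspace T. f y \<in> U}"
      have "openin T V" unfolding V_def using cont U(1) by (simp add: openin_continuous_map_preimage)
      moreover have "K closure_of (f ` V) \<subseteq> K closure_of U"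
        by (rule closure_of_mono) (auto simp: V_def)
      then have "K closure_of (f ` V) \<subseteq> O' n"
        using U(3) closure_of_subset_topspace[of K U] unfolding disjnt_def by blast
      ultimately show "x \<in> \<Union>(\<C> n)" unfolding \<C>_def using x U(2) V_def by blast
    qed
  qed
  moreover have "\<Inter>\<F> \<noteq> {}" if cl: "\<forall>F\<in>\<F>. closedin T F \<and> F \<noteq> {}"
    and dir: "\<forall>E\<in>\<F>. \<forall>F\<in>\<F>. \<exists>D\<in>\<F>. D \<subseteq> E \<inter> F" and small: "\<forall>n. \<exists>F\<in>\<F>. \<exists>U\<in>\<C> n. F \<subseteq> U" for \<F>
  proof -
    have "\<Inter>((\<lambda>F. K closure_of (f ` F)) ` \<F>) \<noteq> {}"
    proof -
      have "\<Inter>\<E> \<noteq> {}" if fin: "finite \<E>" "\<E> \<subseteq> (\<lambda>F. K closure_of (f ` F)) ` \<F>" for \<E>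
      proof (cases "\<E> = {}")
        case False
        obtain \<E>' where E': "\<E>' \<subseteq> \<F>" "finite \<E>'" "\<E> = (\<lambda>F. K closure_of (f ` F)) ` \<E>'"
          using finite_subset_image[OF fin] by blast
        then have "\<E>' \<noteq> {}" using False by auto
        then obtain D where D: "D \<in> \<F>" "D \<subseteq> \<Inter>\<E>'"
          using filter_base_finite_Inter[OF E'(2) _ E'(1)] dir by blast
        obtain x where x: "x \<in> D" using cl D by blast
        have "f x \<in> K closure_of (f ` F)" if "F \<in> \<E>'" for F
        proof -
          have "f ` F \<subseteq> topspace K" using cl that E'(1) fK by (meson closedin_subset image_mono subset_iff)
          then show ?thesis using closure_of_subset[of "f ` F" K] x D(2) that by blast
        qed
        then show ?thesis unfolding E'(3) by blast
      qed simp
      then show ?thesis using K(1) unfolding compact_space_fip by auto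
    qed
    then obtain z where z: "\<And>F. F \<in> \<F> \<Longrightarrow> z \<in> K closure_of (f ` F)" by blast
    have "z \<in> O' n" for n
    proof -
      obtain F U where "F \<in> \<F>" "U \<in> \<C> n" "F \<subseteq> U" using small by blast
      then have "K closure_of (f ` F) \<subseteq> O' n"
        unfolding \<C>_def using closure_of_mono[of "f ` F" "f ` U" K] by blast
      then show ?thesis using z[OF \<open>F \<in> \<F>\<close>] by blast
    qed
    then obtain x where x: "x \<in> topspace T" "z = f x" using O'(2) by blast
    have "x \<in> F" if F: "F \<in> \<F>" for F
    proof -
      have FT: "F \<subseteq> topspace T" using F cl closedin_subset by blast
      have "closedin (subtopology K ?X) (f ` F)"
        using hom cl F homeomorphic_map_closedness_eq FT by (metis homeomorphic_map_closedness)
      then obtain D where D: "closedin K D" "f ` F = D \<inter> ?X" unfolding closedin_subtopology by blast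
      then have "K closure_of (f ` F) \<subseteq> D" by (simp add: closure_of_minimal)
      then have "f x \<in> f ` F" using z[OF F] x D by blast
      then show ?thesis using inj FT x(1) by (meson inj_on_image_mem_iff)
    qed
    then show ?thesis by blast
  qed
  ultimately have "complete_seq T \<C>" unfolding complete_seq_def by (auto simp: \<C>_def)
  then show ?thesis by blast
qed

text \<open>Completeness is applied to the closures of the \<open>U n\<close>. Since each closure
  lies in the preceding set, a point of all closures is a point of all \<open>U n\<close>.\<close>

lemma complete_seq_nested:
  assumes "complete_seq T \<C>" "\<And>n. U n \<noteq> {}" "\<And>n. T closure_of U (Suc n) \<subseteq> U n"
    and sub: "\<And>n. U n \<subseteq> topspace T"
    and "\<And>n. \<exists>c\<in>\<C> n. U (Suc n) \<subseteq> c"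
  shows "\<exists>x. \<forall>n. x \<in> U n"
proof -
  have cs: "U n \<subseteq> T closure_of U n" for n by (rule closure_of_subset[OF sub])
  have "U (Suc n) \<subseteq> U n" for n using cs[of "Suc n"] assms(3)[of n] by (rule subset_trans)
  then have anti: "m \<le> n \<Longrightarrow> U n \<subseteq> U m" for m n by (rule lift_Suc_antimono_le)
  let ?F = "range (\<lambda>n. T closure_of U n)"
  have "\<exists>D\<in>?F. D \<subseteq> (T closure_of U m) \<inter> (T closure_of U n)" for m n
    by (rule bexI[of _ "T closure_of U (max m n)"]) (simp_all add: closure_of_mono anti)
  then have 1: "\<forall>E\<in>?F. \<forall>F\<in>?F. \<exists>D\<in>?F. D \<subseteq> E \<inter> F" by simp
  have "T closure_of U n \<noteq> {}" for n using cs[of n] assms(2)[of n] by auto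
  then have 2: "\<forall>F\<in>?F. closedin T F \<and> F \<noteq> {}" by simp
  have "\<exists>F\<in>?F. \<exists>c\<in>\<C> n. F \<subseteq> c" for n
  proof -
    obtain c where "c \<in> \<C> n" "U (Suc n) \<subseteq> c" using assms(5)[of n] by auto
    \<comment> \<open>Only \<open>U (Suc n)\<close> itself, not its closure, is known to lie in
      \<open>c\<close>, so the closure is taken one index later.\<close>
    then have "T closure_of U (Suc (Suc n)) \<subseteq> c" using assms(3)[of "Suc n"] by (rule_tac subset_trans)
    then show ?thesis using \<open>c \<in> \<C> n\<close> by (intro bexI[of _ c] bexI[of _ "T closure_of U (Suc (Suc n))"]) auto
  qed
  then have 3: "\<forall>n. \<exists>F\<in>?F. \<exists>c\<in>\<C> n. F \<subseteq> c" by (rule allI)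
  have "\<Inter>?F \<noteq> {}" using conjI[OF 2 conjI[OF 1 3]]
    by (rule conjunct2[OF assms(1)[unfolded complete_seq_def], THEN spec, THEN mp])
  then obtain x where x: "\<And>n. x \<in> T closure_of U n" by auto
  have "x \<in> U n" for n using subsetD[OF assms(3) x] .
  then show ?thesis by auto
qed

text \<open>The single step iterated by both the Baire theorem and the Cantor scheme: regularity is
  applied at a point of \<open>U\<close> and \<open>G\<close> inside a member of the cover.\<close>

lemma shrink_open:
  assumes "complete_seq T \<C>" "regular_space T" "dense_open T G" "openin T U" "U \<noteq> {}"
  shows "\<exists>V. openin T V \<and> V \<noteq> {} \<and> T closure_of V \<subseteq> U \<inter> G \<and> (\<exists>c\<in>\<C> n. V \<subseteq> c)"
proof -
  obtain x where x: "x \<in> U" "x \<in> G" using assms(3-5) unfolding dense_open_def by blast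
  have op: "openin T (U \<inter> G)" using assms unfolding dense_open_def by blast
  then obtain c where c: "c \<in> \<C> n" "x \<in> c" "openin T c"
    using x assms(1) unfolding complete_seq_def by (metis IntI UnionE openin_subset subsetD)
  have "openin T (U \<inter> G \<inter> c)" using op c by blast
  then have "closedin T (topspace T - (U \<inter> G \<inter> c))" "x \<in> topspace T - (topspace T - (U \<inter> G \<inter> c))"
    using x c openin_subset by fastforce+
  then obtain V where V: "openin T V" "x \<in> V" "disjnt (topspace T - (U \<inter> G \<inter> c)) (T closure_of V)"
    using assms(2) unfolding regular_space by blast
  then have "T closure_of V \<subseteq> U \<inter> G \<inter> c"
    using closure_of_subset_topspace[of T V] unfolding disjnt_def by blast
  then show ?thesis using V c closure_of_subset[OF openin_subset[OF V(1)]] by blast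
qed

text \<open>The Baire category theorem: shrinking \<open>U\<close> successively into
  \<open>G 0\<close>, \<open>G 1\<close>, ... with small closures leaves a common point by
  completeness.\<close>

lemma complete_seq_Baire:
  assumes C: "complete_seq T \<C>" and reg: "regular_space T"
    and U: "openin T U" "U \<noteq> {}"
  shows "\<not> meager_in T U"
proof
  assume "meager_in T U"
  then obtain G where G: "\<And>n::nat. dense_open T (G n)" "U \<inter> (\<Inter>n. G n) = {}"
    unfolding meager_in_iff by blast
  have "\<forall>n W. \<exists>V. openin T W \<and> W \<noteq> {} \<longrightarrow> openin T V \<and> V \<noteq> {} \<and> T closure_of V \<subseteq> W \<inter> G n
      \<and> (\<exists>c\<in>\<C> n. V \<subseteq> c)" (is "\<forall>n W. \<exists>V. ?P n W V")
    using shrink_open[OF C reg G(1)] by simp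
  then obtain s where "\<forall>n W. ?P n W (s n W)" by metis
  then have s: "openin T W \<Longrightarrow> W \<noteq> {} \<Longrightarrow> openin T (s n W) \<and> s n W \<noteq> {}
      \<and> T closure_of (s n W) \<subseteq> W \<inter> G n \<and> (\<exists>c\<in>\<C> n. s n W \<subseteq> c)" for n W
    by blast
  define V where "V = rec_nat U s"
  have V0: "V 0 = U" and VS: "V (Suc n) = s n (V n)" for n by (simp_all add: V_def)
  have Vop: "openin T (V n) \<and> V n \<noteq> {}" for n
  proof (induction n)
    case (Suc n) then show ?case unfolding VS using s by blast
  qed (simp add: V0 U)
  have cl: "T closure_of V (Suc n) \<subseteq> V n \<inter> G n \<and> (\<exists>c\<in>\<C> n. V (Suc n) \<subseteq> c)" for n
    unfolding VS using s Vop[of n] by blast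
  have sub: "V n \<subseteq> topspace T" for n using Vop openin_subset by blast
  have "\<exists>x. \<forall>n. x \<in> V n"
  proof (rule complete_seq_nested[OF C])
    show "T closure_of V (Suc n) \<subseteq> V n" for n using cl by blast
    show "\<exists>c\<in>\<C> n. V (Suc n) \<subseteq> c" for n using cl by blast
  qed (use Vop sub in auto)
  then obtain x where x: "\<And>n. x \<in> V n" by blast
  have "x \<in> G n" for n
    using x[of "Suc n"] cl[of n] closure_of_subset[OF sub[of "Suc n"]] by blast
  then show False using x[of 0] V0 G(2) by blast
qed

section \<open>A Bernstein set and Cantor schemes\<close>

text \<open>Transfinite recursion: at stage \<open>i\<close> fewer values have been spent than
  \<open>P i\<close> has elements, so a fresh one remains.\<close>

lemma ordLeq_injective_choice:
  fixes P :: "'i \<Rightarrow> 'a set"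
  assumes "\<And>i. |UNIV :: 'i set| \<le>o |P i|"
  shows "\<exists>c. inj c \<and> (\<forall>i. c i \<in> P i)"
proof -
  \<comment> \<open>A cardinal is itself a well-order of least order type on its set. So the
    recursion can run along \<open>?r\<close>, and every \<open>underS\<close> is strictly smaller
    than the whole.\<close>
  let ?r = "|UNIV :: 'i set|"
  have wo: "Well_order ?r" and co: "Card_order ?r" and fi: "Field ?r = UNIV"
    by (simp_all add: card_of_Well_order card_of_Card_order)
  have wf: "wf (?r - Id)" using wo well_order_on_def by blast
  define F where "F g i = (SOME y. y \<in> P i \<and> y \<notin> g ` underS ?r i)" for g :: "'i \<Rightarrow> 'a" and i
  define c where "c = wfrec (?r - Id) F"
  have adm: "adm_wf (?r - Id) F"
    unfolding adm_wf_def
  proof (intro allI impI)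
    fix f g :: "'i \<Rightarrow> 'a" and x assume "\<forall>z. (z, x) \<in> ?r - Id \<longrightarrow> f z = g z"
    then have "f ` underS ?r x = g ` underS ?r x"
      by (intro image_cong) (auto simp: underS_def)
    then show "F f x = F g x" by (simp add: F_def)
  qed
  have c: "c i \<in> P i \<and> c i \<notin> c ` underS ?r i" for i
  proof -
    have "|c ` underS ?r i| \<le>o |underS ?r i|" by (rule card_of_image)
    also have "|underS ?r i| <o ?r" using card_of_underS[OF co] fi by blast
    also have "?r \<le>o |P i|" by (rule assms)
    finally have "\<not> P i \<subseteq> c ` underS ?r i" using card_of_mono1 not_ordLess_ordLeq by blast
    then have "\<exists>y. y \<in> P i \<and> y \<notin> c ` underS ?r i" by blast
    moreover have "c i = F c i" using wfrec_fixpoint[OF wf adm] unfolding c_def by metis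
    ultimately show ?thesis unfolding F_def by (metis (mono_tags, lifting) someI_ex)
  qed
  have "inj c"
  proof (rule injI, rule ccontr)
    fix x y assume e: "c x = c y" "x \<noteq> y"
    have "(x, y) \<in> ?r \<or> (y, x) \<in> ?r"
      using wo fi e(2) unfolding well_order_on_def linear_order_on_def total_on_def by auto
    then have "x \<in> underS ?r y \<or> y \<in> underS ?r x" using e(2) by (auto simp: underS_def)
    then show False using c[of x] c[of y] e(1) by (metis imageI)
  qed
  then show ?thesis using c by blast
qed

primrec branch :: "(nat \<Rightarrow> bool) \<Rightarrow> nat \<Rightarrow> bool list" where
  "branch \<beta> 0 = []"
| "branch \<beta> (Suc n) = \<beta> n # branch \<beta> n"

text \<open>A branch lists its most recent bit first. The maps \<open>tree_map \<tau>\<close> are the continuous self-maps of the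
  Cantor space whose n-th output bit depends on the first n + 1 input bits only. They are coded
  by \<open>\<tau>\<close>, so there are only continuum many of them, as the Bernstein construction needs.\<close>

definition tree_map :: "(bool list \<Rightarrow> bool) \<Rightarrow> (nat \<Rightarrow> bool) \<Rightarrow> nat \<Rightarrow> bool" where
  "tree_map \<tau> \<beta> n = \<tau> (branch \<beta> (Suc n))"

lemma length_branch [simp]: "length (branch \<beta> n) = n"
  by (induction n) auto

lemma branch_cong: "(\<And>i. i < n \<Longrightarrow> \<beta> i = \<gamma> i) \<Longrightarrow> branch \<beta> n = branch \<gamma> n"
  by (induction n) auto

text \<open>A sequence \<open>a\<close> codes a tree map in its tail and a side in its bit
  \<open>a 0\<close>. Each injective tree map thus receives two distinct points of its range, one
  put into \<open>B\<close> and one left out.\<close>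

lemma Bernstein_set:
  "\<exists>B. \<forall>\<tau>. inj (tree_map \<tau>) \<longrightarrow> \<not> range (tree_map \<tau>) \<subseteq> B \<and> \<not> range (tree_map \<tau>) \<subseteq> - B"
proof -
  define code where "code (a :: nat \<Rightarrow> bool) = (\<lambda>s :: bool list. a (Suc (to_nat s)))" for a
  \<comment> \<open>The default \<open>UNIV\<close> for noninjective maps keeps every
    \<open>P a\<close> at least as large as the index type.\<close>
  define P where "P a = (if inj (tree_map (code a)) then range (tree_map (code a)) else UNIV)" for a
  have "|UNIV :: (nat \<Rightarrow> bool) set| \<le>o |P a|" for a
  proof (cases "inj (tree_map (code a))")
    case True then show ?thesis by (auto simp: P_def card_of_ordLeq[symmetric])
  next
    case False then show ?thesis by (simp add: P_def)
  qed
  then obtain c where c: "inj c" "\<And>a. c a \<in> P a" using ordLeq_injective_choice by metis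
  define B where "B = c ` {a. a 0}"
  have "\<not> range (tree_map \<tau>) \<subseteq> B \<and> \<not> range (tree_map \<tau>) \<subseteq> - B" if i: "inj (tree_map \<tau>)" for \<tau>
  proof -
    define a where "a b = case_nat b (\<lambda>n. \<tau> (from_nat n))" for b
    have "code (a b) = \<tau>" for b by (auto simp: code_def a_def)
    then have m: "c (a b) \<in> range (tree_map \<tau>)" for b using c(2)[of "a b"] i by (simp add: P_def)
    have "c (a True) \<in> B" by (simp add: B_def a_def)
    moreover have "c (a False) \<notin> B" 
      by (auto simp: B_def inj_eq[OF c(1)]) (simp add: a_def)
    ultimately show ?thesis using m by blast
  qed
  then show ?thesis by blast
qed

section \<open>Maps to the Cantor space with meager fibres\<close>

text \<open>Each node of the scheme decides one more bit of \<open>f\<close>, so along the scheme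
  \<open>f\<close> becomes a tree map. Meager fibres let every node split into children with
  different values of \<open>f\<close>, so this tree map is injective, and its range lies on one
  side of the Bernstein set.\<close>

lemma no_meager_fibres:
  fixes f :: "'a \<Rightarrow> nat \<Rightarrow> bool"
  assumes C: "complete_seq T \<C>" and reg: "regular_space T"
    and D: "\<not> meager_in T D"
    and bp: "\<And>S. {x \<in> D. f x \<in> S} \<in> baire_property_sets T"
    and fib: "\<And>s. meager_in T {x \<in> D. f x = s}"
  shows False
proof -
  obtain B where B: "\<And>\<tau>. inj (tree_map \<tau>) \<Longrightarrow> \<not> range (tree_map \<tau>) \<subseteq> B \<and> \<not> range (tree_map \<tau>) \<subseteq> - B"
    using Bernstein_set by metis
  have "\<exists>B'\<in>{B, -B}. \<not> meager_in T {x \<in> D. f x \<in> B'}"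
  proof (rule ccontr)
    assume "\<not> ?thesis"
    then have "meager_in T ({x \<in> D. f x \<in> B} \<union> {x \<in> D. f x \<in> - B})" by (intro meager_in_Un) simp_all
    moreover have "{x \<in> D. f x \<in> B} \<union> {x \<in> D. f x \<in> - B} = D" by auto
    ultimately show False using D by simp
  qed
  then obtain B' where "B' \<in> {B, -B}" and nm: "\<not> meager_in T {x \<in> D. f x \<in> B'}" by (rule bexE)
  then have B': "B' = B \<or> B' = - B" by simp
  let ?E = "{x \<in> D. f x \<in> B'}"
  obtain U0 where U0: "openin T U0" "meager_in T (?E - U0)" "meager_in T (U0 - ?E)"
    using baire_property_setsD[OF bp[of B']] by auto
  have "\<exists>V. openin T V \<and> meager_in T ({x \<in> D. f x n} - V) \<and> meager_in T (V - {x \<in> D. f x n})" for n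
    using baire_property_setsD[OF bp[of "{s. s n}"]] by simp
  then obtain V where V: "\<And>n. openin T (V n)" "\<And>n. meager_in T ({x \<in> D. f x n} - V n)"
     "\<And>n. meager_in T (V n - {x \<in> D. f x n})" by metis
  have "U0 \<noteq> {}" using U0(2) nm by auto
  \<comment> \<open>\<open>M\<close> collects all exceptional points: at a point of
    \<open>U0\<close> outside \<open>M\<close>, the value of \<open>f\<close> lies in
    \<open>B'\<close> and its bit \<open>n\<close> is decided by membership in
    \<open>V n\<close>.\<close>
  define M where "M = (U0 - ?E) \<union> (\<Union>n. {x \<in> D. f x n} - V n) \<union> (\<Union>n. V n - {x \<in> D. f x n})"
  have "meager_in T M"
    unfolding M_def by (intro meager_in_Un U0(3) meager_in_Union) (use V in auto)
  then obtain G where G: "\<And>n::nat. dense_open T (G n)" and GM: "M \<inter> (\<Inter>n. G n) = {}"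
    using meager_inE by metis
  have good: "x \<in> D \<and> f x \<in> B' \<and> (\<forall>n. f x n \<longleftrightarrow> x \<in> V n)" if "x \<in> U0" "\<And>n. x \<in> G n" for x
  proof -
    have "x \<notin> M" using GM that(2) by blast
    then show ?thesis unfolding M_def using that(1) by auto
  qed
  \<comment> \<open>If no \<open>k\<close> works, each \<open>V k\<close> misses \<open>U\<close> or
    is dense in it. Then \<open>f\<close> is constant on a comeager part of \<open>U\<close>, so
    \<open>U\<close> is covered by a meager fibre and a meager set, against Baire.\<close>
  have split: "\<exists>k. U \<inter> V k \<noteq> {} \<and> U - T closure_of (V k) \<noteq> {}"
    if U: "openin T U" "U \<noteq> {}" "U \<subseteq> U0" for U
  proof (rule ccontr)
    assume "\<not> ?thesis"
    then have n: "U \<inter> V k = {} \<or> U \<subseteq> T closure_of (V k)" for k by auto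
    define s where "s k \<longleftrightarrow> U \<inter> V k \<noteq> {}" for k
    \<comment> \<open>If \<open>s k\<close> holds, \<open>U\<close> lies in the closure of
      \<open>V k\<close>, so inside \<open>U\<close> the dense open set \<open>H k\<close> reduces
      to \<open>V k\<close>.\<close>
    define H where "H k = (if s k then V k \<union> (topspace T - T closure_of V k) else topspace T)" for k
    have H: "dense_open T (H k)" for k
    proof -
      have "dense_open T (V k \<union> (topspace T - T closure_of V k))"
        unfolding dense_open_def
      proof (intro conjI allI impI)
        fix W assume W: "openin T W \<and> W \<noteq> {}"
        show "(V k \<union> (topspace T - T closure_of V k)) \<inter> W \<noteq> {}"
        proof
          assume e: "(V k \<union> (topspace T - T closure_of V k)) \<inter> W = {}"
          then have "W \<inter> T closure_of V k = {}"
            using openin_Int_closure_of_eq_empty[of T W "V k"] W by blast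
          then show False using e W openin_subset[of T W] by blast
        qed
      qed (simp add: V(1) openin_Un openin_diff)
      moreover have "dense_open T (topspace T)"
        unfolding dense_open_def by (auto dest: openin_subset)
      ultimately show ?thesis by (simp add: H_def)
    qed
    define R where "R = (\<Union>i. topspace T - G i) \<union> (\<Union>j. topspace T - H j)"
    have "meager_in T R"
      unfolding R_def by (intro meager_in_Un meager_in_Union)
        (auto intro!: meager_in_nowhere_dense dense_open_complement G H)
    moreover have "U - {x \<in> D. f x = s} \<subseteq> R"
    proof (rule subsetI, rule ccontr)
      fix x assume x: "x \<in> U - {x \<in> D. f x = s}" "x \<notin> R"
      then have "x \<in> topspace T" using openin_subset[OF U(1)] by auto
      then have g: "x \<in> G i" and h: "x \<in> H j" for i j using x(2) by (auto simp: R_def)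
      have gd: "x \<in> D \<and> (\<forall>n. f x n \<longleftrightarrow> x \<in> V n)" using good[of x] g U(3) x(1) by auto
      have "x \<in> V k \<longleftrightarrow> s k" for k
      proof (cases "s k")
        case True
        then have "x \<in> T closure_of V k" using n[of k] x(1) by (auto simp: s_def)
        then show ?thesis using h[of k] True by (simp add: H_def)
      next
        case False then show ?thesis using x(1) by (auto simp: s_def)
      qed
      then have "f x = s" using gd by auto
      then show False using x(1) gd by simp
    qed
    ultimately have "meager_in T (U - {x \<in> D. f x = s})" by (rule meager_in_subset)
    then have "meager_in T ((U - {x \<in> D. f x = s}) \<union> {x \<in> D. f x = s})"
      using fib by (rule meager_in_Un)
    then have "meager_in T U" by (rule meager_in_subset) auto
    then show False using complete_seq_Baire[OF C reg U(1,2)] by simp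
  qed
  \<comment> \<open>Level \<open>n\<close> does three things at once: it enters \<open>G n\<close>,
    becomes small for cover \<open>n\<close>, and decides bit \<open>n\<close> of
    \<open>f\<close>.\<close>
  define P where "P n U W \<longleftrightarrow> openin T W \<and> W \<noteq> {} \<and> T closure_of W \<subseteq> U \<inter> G n \<and> (\<exists>c\<in>\<C> n. W \<subseteq> c)
     \<and> (W \<subseteq> V n \<or> W \<inter> V n = {})" for n U W
  have shrink: "\<exists>W. P n U W" if "openin T U" "U \<noteq> {}" for n U
  proof -
    define U' where "U' = (if U \<inter> V n = {} then U else U \<inter> V n)"
    have "openin T U'" "U' \<noteq> {}" using that V(1) by (auto simp: U'_def)
    then obtain W where W: "openin T W" "W \<noteq> {}" "T closure_of W \<subseteq> U' \<inter> G n" "\<exists>c\<in>\<C> n. W \<subseteq> c"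
      using shrink_open[OF C reg G[of n], of U' n] by auto
    have "W \<subseteq> T closure_of W" using W(1) by (rule openin_subset_closure_of)
    then have "W \<subseteq> U'" using W(3) by auto
    moreover have "T closure_of W \<subseteq> U \<inter> G n" using W(3) by (auto simp: U'_def split: if_splits)
    ultimately have "P n U W" using W unfolding P_def U'_def by (auto split: if_splits)
    then show ?thesis by auto
  qed
  have "\<exists>W k. P n U (W True) \<and> P n U (W False) \<and> W True \<subseteq> V k \<and> W False \<inter> V k = {}"
    if U: "openin T U" "U \<noteq> {}" "U \<subseteq> U0" for n U
  proof -
    \<comment> \<open>The index \<open>k\<close> need not be related to the level \<open>n\<close>:
      it only separates the values of \<open>f\<close> on the two children. Removing the closure of
      \<open>V k\<close> keeps the second child open.\<close>
    obtain k where k: "U \<inter> V k \<noteq> {}" "U - T closure_of (V k) \<noteq> {}" using split[OF U] by auto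
    have "openin T (U \<inter> V k)" "openin T (U - T closure_of (V k))"
      by (simp_all add: U V openin_Int openin_diff)
    then obtain W1 W2 where W: "P n (U \<inter> V k) W1" "P n (U - T closure_of (V k)) W2"
      using shrink k by metis
    have s: "W1 \<subseteq> T closure_of W1" "W2 \<subseteq> T closure_of W2" "V k \<subseteq> T closure_of V k"
      using W V unfolding P_def by (auto intro!: openin_subset_closure_of del: subsetI)
    have "P n U W1" "P n U W2" using W by (auto simp: P_def)
    moreover have "W1 \<subseteq> V k" using s W(1) by (auto simp: P_def)
    moreover have "W2 \<inter> V k = {}" using s W(2) unfolding P_def by (simp add: disjoint_iff subset_iff) metis
    ultimately show ?thesis by (intro exI[of _ "\<lambda>b. if b then W1 else W2"] exI[of _ k]) simp
  qed
  then have "\<forall>n U. \<exists>W. openin T U \<and> U \<noteq> {} \<and> U \<subseteq> U0 \<longrightarrow>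
      (\<exists>k. P n U (W True) \<and> P n U (W False) \<and> W True \<subseteq> V k \<and> W False \<inter> V k = {})" 
    by metis
  then obtain st where st: "\<And>n U. openin T U \<Longrightarrow> U \<noteq> {} \<Longrightarrow> U \<subseteq> U0 \<Longrightarrow> 
      \<exists>k. P n U (st n U True) \<and> P n U (st n U False) \<and> st n U True \<subseteq> V k \<and> st n U False \<inter> V k = {}"
    by metis
  \<comment> \<open>Nodes list the latest bit first, matching \<open>branch\<close>, so the length
    of the tail is the level of the step.\<close>
  define W where "W = rec_list U0 (\<lambda>b s. \<lambda>U. st (length s) U b)"
  have W0: "W [] = U0" and WS: "W (b # s) = st (length s) (W s) b" for b s by (simp_all add: W_def)
  have Wop: "openin T (W s) \<and> W s \<noteq> {} \<and> W s \<subseteq> U0" for s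
  proof (induction s)
    case (Cons b s)
    then have "P (length s) (W s) (W (b # s))"
      using st[of "W s" "length s"] unfolding WS by (cases b) auto
    then have p: "openin T (W (b # s)) \<and> W (b # s) \<noteq> {} \<and> T closure_of W (b # s) \<subseteq> W s"
      by (simp add: P_def)
    then have "W (b # s) \<subseteq> T closure_of W (b # s)" using openin_subset_closure_of by blast
    then show ?case using p Cons by auto
  qed (use U0 \<open>U0 \<noteq> {}\<close> in \<open>simp add: W0\<close>)
  have WP: "P (length s) (W s) (W (b # s))" for b s
    using st[of "W s" "length s"] Wop[of s] unfolding WS by (cases b) auto
  have Wk: "\<exists>k. W (True # s) \<subseteq> V k \<and> W (False # s) \<inter> V k = {}" for s
    using st[of "W s" "length s"] Wop[of s] unfolding WS by auto
  have "\<exists>x. \<forall>n. x \<in> W (branch \<beta> n)" for \<beta>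
  proof (rule complete_seq_nested[OF C])
    show "T closure_of W (branch \<beta> (Suc n)) \<subseteq> W (branch \<beta> n)" for n
      using WP[of "branch \<beta> n" "\<beta> n"] by (simp add: P_def)
    show "\<exists>c\<in>\<C> n. W (branch \<beta> (Suc n)) \<subseteq> c" for n
      using WP[of "branch \<beta> n" "\<beta> n"] by (simp add: P_def)
    show "W (branch \<beta> n) \<subseteq> topspace T" for n using Wop by (intro openin_subset) simp
  qed (use Wop in simp)
  then obtain p where p: "\<And>\<beta> n. p \<beta> \<in> W (branch \<beta> n)" by metis
  have pg: "p \<beta> \<in> D \<and> f (p \<beta>) \<in> B' \<and> (\<forall>n. f (p \<beta>) n \<longleftrightarrow> p \<beta> \<in> V n)" for \<beta>
  proof (rule good)
    show "p \<beta> \<in> U0" using p[of \<beta> 0] by (simp add: W0)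
    show "p \<beta> \<in> G n" for n
    proof -
      have "W (branch \<beta> (Suc n)) \<subseteq> T closure_of W (branch \<beta> (Suc n))"
        using Wop by (intro openin_subset_closure_of) simp
      then show ?thesis using WP[of "branch \<beta> n" "\<beta> n"] p[of \<beta> "Suc n"] by (auto simp: P_def)
    qed
  qed
  \<comment> \<open>A node of length \<open>n + 1\<close> is the one that decides bit
    \<open>n\<close>; hence the index \<open>length s - 1\<close>.\<close>
  define \<tau> where "\<tau> s \<longleftrightarrow> W s \<subseteq> V (length s - 1)" for s
  have ftau: "f (p \<beta>) = tree_map \<tau> \<beta>" for \<beta>
  proof
    fix n
    have "W (branch \<beta> (Suc n)) \<subseteq> V n \<or> W (branch \<beta> (Suc n)) \<inter> V n = {}"
      using WP[of "branch \<beta> n" "\<beta> n"] by (simp add: P_def)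
    then have "p \<beta> \<in> V n \<longleftrightarrow> W (branch \<beta> (Suc n)) \<subseteq> V n" using p[of \<beta> "Suc n"] by auto
    then show "f (p \<beta>) n = tree_map \<tau> \<beta> n" using pg by (simp add: tree_map_def \<tau>_def)
  qed
  have "inj (tree_map \<tau>)"
  proof (rule injI, rule ccontr)
    fix \<beta> \<gamma> assume e: "tree_map \<tau> \<beta> = tree_map \<tau> \<gamma>" "\<beta> \<noteq> \<gamma>"
    \<comment> \<open>Two branches share their node of length \<open>n\<close>, where
      \<open>n\<close> is the first difference, and leave it through separated children.\<close>
    define n where "n = (LEAST n. \<beta> n \<noteq> \<gamma> n)"
    have "\<exists>n. \<beta> n \<noteq> \<gamma> n" using e(2) by auto
    then have n: "\<beta> n \<noteq> \<gamma> n" unfolding n_def by (rule LeastI_ex)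
    have "\<beta> i = \<gamma> i" if "i < n" for i using not_less_Least[of i "\<lambda>n. \<beta> n \<noteq> \<gamma> n"] that by (auto simp: n_def)
    then have b: "branch \<beta> n = branch \<gamma> n" by (rule branch_cong)
    obtain k where k: "W (True # branch \<beta> n) \<subseteq> V k \<and> W (False # branch \<beta> n) \<inter> V k = {}"
      using Wk by metis
    have "p \<beta> \<in> W (\<beta> n # branch \<beta> n)" "p \<gamma> \<in> W (\<gamma> n # branch \<beta> n)"
      using p[of \<beta> "Suc n"] p[of \<gamma> "Suc n"] b by simp_all
    then have "p \<beta> \<in> V k \<longleftrightarrow> p \<gamma> \<notin> V k" using k n by (cases "\<beta> n") auto
    then have "f (p \<beta>) k \<noteq> f (p \<gamma>) k" using pg by simp
    then show False using e(1) ftau by simp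
  qed
  moreover have "range (tree_map \<tau>) \<subseteq> B'" using pg ftau by (metis image_subsetI)
  ultimately show False using B B' by metis
qed

section \<open>Discrete refinement of a cover by meager balls\<close>

text \<open>A. H. Stone's \<open>\<sigma>\<close>-discrete refinement: the least-index map \<open>t\<close> cuts the space into countably many
  disjoint families of meager sets all of whose subunions have the Baire property. The code \<open>\<phi>\<close>
  bounds the number of pieces by the continuum.\<close>

lemma no_meager_entourage:
  fixes R :: "nat \<Rightarrow> 'a \<Rightarrow> 'a \<Rightarrow> bool" and \<phi> :: "'a \<Rightarrow> nat \<Rightarrow> bool"
  assumes C: "complete_seq T \<C>" and reg: "regular_space T"
    and ne: "topspace T \<noteq> {}"
    and dom: "\<And>n x y. R n x y \<Longrightarrow> x \<in> topspace T \<and> y \<in> topspace T"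
    and refl: "\<And>n x. x \<in> topspace T \<Longrightarrow> R n x x"
    and sym: "\<And>n x y. R n x y \<Longrightarrow> R n y x"
    and trans: "\<And>n x y z. R (Suc n) x y \<Longrightarrow> R (Suc n) y z \<Longrightarrow> R n x z"
    and bp: "\<And>n S. {y. \<exists>x\<in>S. R n x y} \<in> baire_property_sets T"
    and meager: "\<And>x. meager_in T {y. R 0 x y}"
    and code: "\<And>n x y. x \<in> topspace T \<Longrightarrow> y \<in> topspace T \<Longrightarrow> \<phi> x = \<phi> y \<Longrightarrow> R n x y"
  shows False
proof -
  have mono: "R (Suc n) x y \<Longrightarrow> R n x y" for n x y using trans refl dom by metis
  obtain r :: "'a rel" where r: "Well_order r" "Field r = UNIV" using well_ordering by metis
  interpret wo_rel r using r(1) by (simp add: wo_rel_def)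
  \<comment> \<open>With the \<open>R n\<close> as entourages, \<open>S x\<close> holds the centres
    \<open>g\<close> whose level 0 ball contains some ball around \<open>x\<close>; \<open>t\<close>
    picks the least one in a well-order of the type.\<close>
  define S where "S x = {g. \<exists>n. \<forall>y. R n x y \<longrightarrow> R 0 g y}" for x
  define t where "t x = minim (S x)" for x
  have tS: "t x \<in> S x" and tle: "g \<in> S x \<Longrightarrow> (t x, g) \<in> r" for x g
  proof -
    have "x \<in> S x" by (auto simp: S_def)
    then show "t x \<in> S x" unfolding t_def by (intro minim_in) (auto simp: r(2))
    show "g \<in> S x \<Longrightarrow> (t x, g) \<in> r" unfolding t_def by (intro minim_least) (simp_all add: r(2))
  qed
  define Q where "Q n = {x \<in> topspace T. \<forall>y. R n x y \<longrightarrow> R 0 (t x) y}" for n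
  \<comment> \<open>Points of \<open>Q n\<close> joined through \<open>y\<close> at level
    \<open>n + 2\<close> are close at level \<open>n + 1\<close>. The smaller ball of either one
    then lies in the level \<open>n\<close> ball of the other, so each value of \<open>t\<close> is
    a candidate for the other point, and minimality makes them equal.\<close>
  have eq: "t x = t x'" if x: "x \<in> Q n" "x' \<in> Q n" "R (Suc (Suc n)) x y" "R (Suc (Suc n)) x' y" for x x' y n
  proof -
    have *: "t x \<in> S x'" if "x \<in> Q n" "R (Suc n) x x'" for x x'
    proof -
      have "R 0 (t x) z" if "R (Suc n) x' z" for z
        using trans[OF \<open>R (Suc n) x x'\<close> that] \<open>x \<in> Q n\<close> by (simp add: Q_def)
      then show ?thesis unfolding S_def by blast
    qed
    have "R (Suc n) x x'" using trans[OF x(3) sym[OF x(4)]] .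
    then have "t x \<in> S x'" "t x' \<in> S x" using *[OF x(1)] *[OF x(2)] sym by simp_all
    then have "(t x', t x) \<in> r" "(t x, t x') \<in> r" using tle by simp_all
    then show ?thesis using ANTISYM by (simp add: antisym_def)
  qed
  \<comment> \<open>Points with equal codes are close at every level, so they have the same
    candidates. Hence \<open>t\<close> takes at most continuum many values on the space.\<close>
  have codet: "t x = t y" if "x \<in> topspace T" "y \<in> topspace T" "\<phi> x = \<phi> y" for x y
  proof -
    have *: "S x \<subseteq> S y" if "x \<in> topspace T" "y \<in> topspace T" "\<phi> x = \<phi> y" for x y
    proof
      fix g assume "g \<in> S x"
      then obtain n where n: "\<And>z. R n x z \<Longrightarrow> R 0 g z" unfolding S_def by blast
      have "R 0 g z" if "R (Suc n) y z" for z
        using n trans[OF code[OF \<open>x \<in> _\<close> \<open>y \<in> _\<close> \<open>\<phi> x = _\<close>] that] by simp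
      then show "g \<in> S y" unfolding S_def by blast
    qed
    have "S x = S y" using *[of x y] *[of y x] that by (metis subset_antisym)
    then show ?thesis by (simp add: t_def)
  qed
  \<comment> \<open>Enlarging by level \<open>n + 2\<close> makes all unions of pieces have the
    Baire property through \<open>bp\<close>, while \<open>eq\<close> keeps pieces with different
    \<open>t\<close> disjoint.\<close>
  define D where "D n = {y. \<exists>x\<in>Q n. R (Suc (Suc n)) x y}" for n
  have "topspace T \<subseteq> (\<Union>n. D n)"
  proof
    fix x assume x: "x \<in> topspace T"
    obtain n where "\<And>y. R n x y \<Longrightarrow> R 0 (t x) y" using tS[of x] unfolding S_def by blast
    then have "x \<in> Q n" using x by (simp add: Q_def)
    then have "x \<in> D n" using refl[OF x, of "Suc (Suc n)"] unfolding D_def by blast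
    then show "x \<in> (\<Union>n. D n)" by blast
  qed
  have "\<exists>n. \<not> meager_in T (D n)"
  proof (rule ccontr)
    assume "\<not> ?thesis"
    then have "meager_in T (\<Union>n. D n)" by (intro meager_in_Union) auto
    then have "meager_in T (topspace T)" using \<open>topspace T \<subseteq> _\<close> by (rule meager_in_subset)
    then show False using complete_seq_Baire[OF C reg openin_topspace ne] by simp
  qed
  then obtain n where n: "\<not> meager_in T (D n)" by blast
  define rep where "rep y = (SOME x. x \<in> Q n \<and> R (Suc (Suc n)) x y)" for y
  have rep: "rep y \<in> Q n \<and> R (Suc (Suc n)) (rep y) y" if "y \<in> D n" for y
  proof -
    have "\<exists>x. x \<in> Q n \<and> R (Suc (Suc n)) x y" using that by (auto simp: D_def)
    then show ?thesis unfolding rep_def by (rule someI_ex)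
  qed
  \<comment> \<open>A value of \<open>t\<close> is labelled by the code of a chosen point attaining
    it; \<open>codet\<close> makes the labelling injective.\<close>
  define \<psi> where "\<psi> g = \<phi> (SOME x. x \<in> topspace T \<and> t x = g)" for g
  define f where "f y = \<psi> (t (rep y))" for y
  have inj: "t x = t y" if "x \<in> topspace T" "y \<in> topspace T" "\<psi> (t x) = \<psi> (t y)" for x y
  proof -
    have *: "(SOME z. z \<in> topspace T \<and> t z = t x) \<in> topspace T \<and> t (SOME z. z \<in> topspace T \<and> t z = t x) = t x"
      if "x \<in> topspace T" for x
      using someI[of "\<lambda>z. z \<in> topspace T \<and> t z = t x" x] that by simp
    show ?thesis using codet *[OF that(1)] *[OF that(2)] that(3) unfolding \<psi>_def by metis
  qed
  have fS: "{y \<in> D n. f y \<in> A} = {y. \<exists>x\<in>{x \<in> Q n. \<psi> (t x) \<in> A}. R (Suc (Suc n)) x y}" for A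
  proof (intro equalityI subsetI)
    fix y assume "y \<in> {y \<in> D n. f y \<in> A}"
    then have "rep y \<in> {x \<in> Q n. \<psi> (t x) \<in> A}" "R (Suc (Suc n)) (rep y) y"
      using rep[of y] by (simp_all add: f_def)
    then show "y \<in> {y. \<exists>x\<in>{x \<in> Q n. \<psi> (t x) \<in> A}. R (Suc (Suc n)) x y}" by blast
  next
    fix y assume "y \<in> {y. \<exists>x\<in>{x \<in> Q n. \<psi> (t x) \<in> A}. R (Suc (Suc n)) x y}"
    then obtain x where x: "x \<in> Q n" "\<psi> (t x) \<in> A" "R (Suc (Suc n)) x y" by blast
    then have "y \<in> D n" unfolding D_def by blast
    moreover have "t (rep y) = t x" using eq rep[OF \<open>y \<in> D n\<close>] x by blast
    ultimately show "y \<in> {y \<in> D n. f y \<in> A}" using x(2) by (simp add: f_def)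
  qed
  show False
  proof (rule no_meager_fibres[OF C reg n])
    show "{x \<in> D n. f x \<in> A} \<in> baire_property_sets T" for A unfolding fS by (rule bp)
    show "meager_in T {x \<in> D n. f x = s}" for s
    proof (cases "{x \<in> D n. f x = s} = {}")
      case True then show ?thesis by (simp only: meager_in_empty)
    next
      case False
      then obtain z where z: "z \<in> D n" "f z = s" by blast
      \<comment> \<open>On a fibre \<open>t (rep y)\<close> is constant, and \<open>rep y\<close> in
        \<open>Q n\<close> places \<open>y\<close> in the level 0 ball of that centre, which is
        meager.\<close>
      have "{x \<in> D n. f x = s} \<subseteq> {y. R 0 (t (rep z)) y}"
      proof
        fix y assume y: "y \<in> {x \<in> D n. f x = s}"
        then have "t (rep y) = t (rep z)"
          using rep z by (intro inj) (auto simp: Q_def f_def)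
        moreover have "R n (rep y) y" using rep[of y] y mono by blast
        ultimately show "y \<in> {y. R 0 (t (rep z)) y}" using rep[of y] y by (simp add: Q_def)
      qed
      with meager show ?thesis by (rule meager_in_subset)
    qed
  qed
qed

lemma meager_in_homeomorphic_image:
  assumes f: "homeomorphic_map T T' f" and "meager_in T S"
  shows "meager_in T' (f ` S)"
proof -
  have ST: "S \<subseteq> topspace T" using assms(2) by (rule meager_in_subset_topspace)
  obtain G where G: "\<And>n::nat. dense_open T (G n)" "S \<inter> (\<Inter>n. G n) = {}"
    using meager_inE[OF assms(2)] by blast
  have GT: "G n \<subseteq> topspace T" for n using G(1)[of n] openin_subset by (auto simp: dense_open_def)
  have img: "f ` topspace T = topspace T'" by (rule homeomorphic_imp_surjective_map[OF f])
  have inj: "inj_on f (topspace T)" by (rule homeomorphic_imp_injective_map[OF f])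
  have "dense_open T' (f ` G n)" for n
    using G(1)[of n] homeomorphic_map_closure_of[OF f GT[of n]] homeomorphic_map_openness[OF f GT[of n]]
    by (simp add: dense_open_closure img)
  moreover have "f ` S \<inter> (\<Inter>n. f ` G n) = {}"
  proof (rule equals0I)
    fix y assume y: "y \<in> f ` S \<inter> (\<Inter>n. f ` G n)"
    then obtain x where x: "x \<in> S" "y = f x" by blast
    have "x \<in> G n" for n
    proof -
      have "f x \<in> f ` G n" using y x(2) by blast
      then show ?thesis using inj_on_image_mem_iff[OF inj _ GT] ST x(1) by blast
    qed
    then show False using G(2) x(1) by blast
  qed
  moreover have "f ` S \<subseteq> topspace T'" using ST img by blast
  ultimately show ?thesis unfolding meager_in_iff by (intro conjI exI[of _ "\<lambda>n. f ` G n"] allI)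
qed

section \<open>Topological groups\<close>

text \<open>Witnesses and values of \<open>g\<close> are added in countably many rounds. An element
  entering at round \<open>n\<close> gets its witnesses at round \<open>n + 1\<close>, and
  monotonicity of \<open>Q u\<close> carries them to the union.\<close>

lemma countable_closing_off:
  fixes A P :: "'a set"
  assumes A: "countable A" "A \<subseteq> P"
    and F: "\<And>u. u \<in> P \<Longrightarrow> \<exists>F. countable F \<and> F \<subseteq> P \<and> Q u F"
    and mono: "\<And>u E F. Q u E \<Longrightarrow> E \<subseteq> F \<Longrightarrow> Q u F"
    and g: "\<And>u v. u \<in> P \<Longrightarrow> v \<in> P \<Longrightarrow> g u v \<in> P"
  shows "\<exists>S. countable S \<and> A \<subseteq> S \<and> S \<subseteq> P \<and> (\<forall>u\<in>S. Q u S) \<and> (\<forall>u\<in>S. \<forall>v\<in>S. g u v \<in> S)"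
proof -
  obtain F where F: "\<And>u. u \<in> P \<Longrightarrow> countable (F u) \<and> F u \<subseteq> P \<and> Q u (F u)" using F by metis
  define step where "step Y = Y \<union> (\<Union>u\<in>Y. F u) \<union> (\<lambda>(u, v). g u v) ` (Y \<times> Y)" for Y
  define S where "S n = (step ^^ n) A" for n
  have S0: "S 0 = A" and SS: "S (Suc n) = step (S n)" for n by (simp_all add: S_def)
  have S: "countable (S n) \<and> S n \<subseteq> P" for n
  proof (induction n)
    case 0 then show ?case using A by (simp add: S0)
  next
    case (Suc n)
    have "countable (F u)" if "u \<in> S n" for u using Suc F that by blast
    then have "countable (step (S n))" unfolding step_def using Suc by simp
    moreover have "u \<in> P" if "u \<in> S n" for u using Suc that by blast
    then have "step (S n) \<subseteq> P" unfolding step_def using F g by fast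
    ultimately show ?case by (simp add: SS)
  qed
  have "S n \<subseteq> S (Suc n)" for n unfolding SS step_def by auto
  then have mS: "m \<le> n \<Longrightarrow> S m \<subseteq> S n" for m n by (rule lift_Suc_mono_le)
  let ?S = "\<Union>n. S n"
  have Q: "Q u ?S" if "u \<in> S n" for u n
  proof (rule mono)
    show "Q u (F u)" using F S that by blast
    have "F u \<subseteq> S (Suc n)" unfolding SS step_def using that by auto
    then show "F u \<subseteq> ?S" by blast
  qed
  have gS: "g u v \<in> ?S" if uv: "u \<in> S m" "v \<in> S n" for u v m n
  proof -
    have "u \<in> S (max m n)" "v \<in> S (max m n)"
      using mS[of m "max m n"] mS[of n "max m n"] uv by auto
    then have "g u v \<in> S (Suc (max m n))" unfolding SS step_def by auto
    then show ?thesis by blast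
  qed
  show ?thesis
  proof (intro exI[of _ ?S] conjI ballI)
    show "countable ?S" using S by simp
    show "A \<subseteq> ?S" using S0 by blast
    show "?S \<subseteq> P" using S by blast
  qed (use Q gS in auto)
qed

section \<open>Translations and neighbourhoods in a topological group\<close>

locale topgroup = group G for G :: "('a, 'b) monoid_scheme" (structure) +
  fixes T :: "'a topology"
  assumes topspace: "topspace T = carrier G"
    and mult: "continuous_map (prod_topology T T) T (\<lambda>(x, y). x \<otimes> y)"
    and inverse: "continuous_map T T (\<lambda>x. inv x)"

lemma topological_group_iff: "topological_group G T \<longleftrightarrow> topgroup G T"
  by (simp add: topological_group_def topgroup_def topgroup_axioms_def)

context topgroup
begin

lemma inv_cancel:
  "x \<in> carrier G \<Longrightarrow> y \<in> carrier G \<Longrightarrow> inv x \<otimes> (x \<otimes> y) = y"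
  "x \<in> carrier G \<Longrightarrow> y \<in> carrier G \<Longrightarrow> x \<otimes> (inv x \<otimes> y) = y"
  by (simp_all add: m_assoc[symmetric])

lemma openin_carrier: "openin T U \<Longrightarrow> x \<in> U \<Longrightarrow> x \<in> carrier G"
  using openin_subset[of T U] topspace by auto

lemma continuous_map_translate:
  assumes x: "x \<in> carrier G"
  shows "continuous_map T T (\<lambda>y. x \<otimes> y)" "continuous_map T T (\<lambda>y. y \<otimes> x)"
proof -
  have "continuous_map T (prod_topology T T) (\<lambda>y. (x, y))" "continuous_map T (prod_topology T T) (\<lambda>y. (y, x))"
    using x by (simp_all add: continuous_map_pairwise o_def topspace)
  from this[THEN continuous_map_compose, OF mult]
  show "continuous_map T T (\<lambda>y. x \<otimes> y)" "continuous_map T T (\<lambda>y. y \<otimes> x)"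
    by (simp_all add: o_def)
qed

lemma openin_translate:
  assumes "x \<in> carrier G" "openin T U"
  shows "openin T {y \<in> carrier G. x \<otimes> y \<in> U}" "openin T {y \<in> carrier G. y \<otimes> x \<in> U}"
  using continuous_map_translate[OF assms(1)] assms(2)
  by (auto simp: topspace[symmetric] intro: openin_continuous_map_preimage)

lemma meager_in_translate:
  assumes "x \<in> carrier G" "meager_in T S" shows "meager_in T ((\<lambda>y. y \<otimes> x) ` S)"
proof (rule meager_in_homeomorphic_image)
  have "homeomorphic_maps T T (\<lambda>y. y \<otimes> x) (\<lambda>y. y \<otimes> inv x)"
    using assms(1) by (simp add: homeomorphic_maps_def continuous_map_translate topspace m_assoc)
  then show "homeomorphic_map T T (\<lambda>y. y \<otimes> x)" by (auto simp: homeomorphic_map_maps)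
qed fact

lemma sym_nbhd:
  assumes U: "openin T U" "\<one> \<in> U"
  obtains V where "openin T V" "\<one> \<in> V" "\<And>x. x \<in> V \<Longrightarrow> inv x \<in> V"
    "\<And>x y. x \<in> V \<Longrightarrow> y \<in> V \<Longrightarrow> x \<otimes> y \<in> U"
proof -
  define S where "S = {p \<in> topspace (prod_topology T T). (case p of (x, y) \<Rightarrow> x \<otimes> y) \<in> U}"
  have "openin (prod_topology T T) S"
    unfolding S_def using mult U(1) by (rule openin_continuous_map_preimage)
  moreover have "(\<one>, \<one>) \<in> S" using U(2) by (simp add: S_def topspace)
  ultimately have "\<exists>V1 V2. openin T V1 \<and> openin T V2 \<and> \<one> \<in> V1 \<and> \<one> \<in> V2 \<and> V1 \<times> V2 \<subseteq> S"
    by (simp only: openin_prod_topology_alt)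
  then obtain V1 V2 where V: "openin T V1" "openin T V2" "\<one> \<in> V1" "\<one> \<in> V2" "V1 \<times> V2 \<subseteq> S"
    by (elim exE conjE) (rule that)
  define V0 where "V0 = V1 \<inter> V2"
  define V where "V = V0 \<inter> {x \<in> carrier G. inv x \<in> V0}"
  have "openin T {x \<in> carrier G. inv x \<in> V0}"
    unfolding topspace[symmetric] V0_def
    by (rule openin_continuous_map_preimage[OF inverse]) (use V in auto)
  then have "openin T V" using V by (simp add: V_def V0_def openin_Int)
  moreover have "\<one> \<in> V" using V by (simp add: V_def V0_def)
  moreover have "inv x \<in> V" if "x \<in> V" for x using that by (simp add: V_def)
  moreover have "x \<otimes> y \<in> U" if "x \<in> V" "y \<in> V" for x y
    using subsetD[OF V(5), of "(x, y)"] that by (simp add: V_def V0_def S_def)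
  ultimately show ?thesis using that by simp
qed

section \<open>The Pettis argument\<close>

text \<open>Let \<open>A\<close> agree with the open set \<open>U\<close> up to a meager set, and
  take \<open>N\<close> to be the set of quotients \<open>inv u \<otimes> v\<close> with
  \<open>u\<close>, \<open>v\<close> in \<open>U\<close>. For \<open>y\<close> in \<open>N\<close>
  the open set \<open>U\<close> meets its translate by \<open>y\<close> in a nonmeager set, so
  \<open>A\<close> must meet its own translate there.\<close>

lemma Pettis:
  assumes C: "complete_seq T \<C>" and reg: "regular_space T"
    and A: "A \<in> baire_property_sets T" "\<not> meager_in T A"
  obtains N where "openin T N" "\<one> \<in> N" "\<And>y. y \<in> N \<Longrightarrow> \<exists>a\<in>A. \<exists>b\<in>A. y = inv b \<otimes> a"
proof -
  obtain U where U: "openin T U" "meager_in T (A - U)" "meager_in T (U - A)"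
    using baire_property_setsD[OF A(1)] by blast
  have "U \<noteq> {}" using U(2) A(2) by auto
  then obtain u where u: "u \<in> U" by blast
  have Uc: "x \<in> U \<Longrightarrow> x \<in> carrier G" for x using openin_carrier U(1) by blast
  show ?thesis
  proof
    let ?N = "\<Union>u\<in>U. {y \<in> carrier G. u \<otimes> y \<in> U}"
    show "openin T ?N" using openin_translate(1) U(1) Uc by (intro openin_Union) auto
    show "\<one> \<in> ?N" using u Uc by auto
    fix y assume "y \<in> ?N"
    then obtain v where v: "v \<in> U" "y \<in> carrier G" "v \<otimes> y \<in> U" by blast
    let ?W = "U \<inter> {z \<in> carrier G. z \<otimes> inv y \<in> U}"
    have "openin T ?W" using U(1) openin_translate(2)[of "inv y"] v(2) by (simp add: openin_Int)
    moreover have "v \<otimes> y \<in> ?W" using v Uc by (simp add: m_assoc)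
    ultimately have nm: "\<not> meager_in T ?W" using complete_seq_Baire[OF C reg] by (metis empty_iff)
    show "\<exists>a\<in>A. \<exists>b\<in>A. y = inv b \<otimes> a"
    proof (rule ccontr)
      assume no: "\<not> ?thesis"
      have sub: "?W \<subseteq> (U - A) \<union> (\<lambda>x. x \<otimes> y) ` (U - A)"
      proof
        fix z assume z: "z \<in> ?W"
        have zy: "z = (z \<otimes> inv y) \<otimes> y" "y = inv (z \<otimes> inv y) \<otimes> z"
          using z v(2) by (simp_all add: m_assoc inv_mult_group)
        show "z \<in> (U - A) \<union> (\<lambda>x. x \<otimes> y) ` (U - A)"
        proof (cases "z \<in> A")
          case True
          then have "z \<otimes> inv y \<notin> A" using no zy(2) by blast
          then have "z \<otimes> inv y \<in> U - A" using z by simp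
          then show ?thesis using zy(1) by blast
        next
          case False then show ?thesis using z by simp
        qed
      qed
      have "meager_in T ((U - A) \<union> (\<lambda>x. x \<otimes> y) ` (U - A))"
        using U(3) v(2) by (intro meager_in_Un meager_in_translate)
      from meager_in_subset[OF this sub] show False using nm by (rule_tac notE)
    qed
  qed
qed

section \<open>The normal subgroup respecting countably many dense open sets\<close>

text \<open>The third clause of \<open>Q\<close> below makes the K-invariant core of each \<open>D m\<close> meet every nonempty K-invariant
  open set. The complement of its closure is such a set, so the core is dense; no chain condition is
  needed.\<close>

lemma invariant_kernel:
  fixes D :: "nat \<Rightarrow> 'a set"
  assumes narrow: "omega_narrow G T" and C: "complete_seq T \<C>" and reg: "regular_space T"
    and D: "\<And>m. dense_open T (D m)"
  obtains K and \<phi> :: "'a \<Rightarrow> nat \<Rightarrow> bool" where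
    "subgroup K G" "\<And>x k. x \<in> carrier G \<Longrightarrow> k \<in> K \<Longrightarrow> x \<otimes> k \<otimes> inv x \<in> K"
    "\<And>m. dense_open T {x \<in> carrier G. \<forall>k\<in>K. x \<otimes> k \<in> D m}"
    "\<And>x y. x \<in> carrier G \<Longrightarrow> y \<in> carrier G \<Longrightarrow> \<phi> x = \<phi> y \<Longrightarrow> inv x \<otimes> y \<in> K"
proof -
  define P where "P = {U. openin T U \<and> \<one> \<in> U}"
  \<comment> \<open>In a family closed under \<open>Q\<close>, the first clause makes the
    intersection a subgroup that is also the intersection of the closures; the second makes it
    normal.\<close>
  define Q where "Q U F \<longleftrightarrow>
      (\<exists>V\<in>F. T closure_of V \<subseteq> U \<and> (\<forall>x\<in>V. \<forall>y\<in>V. x \<otimes> y \<in> U \<and> inv x \<otimes> y \<in> U)) \<and>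
      (\<forall>x\<in>carrier G. \<exists>V\<in>F. \<forall>v\<in>V. x \<otimes> v \<otimes> inv x \<in> U) \<and>
      (\<forall>m. \<forall>x\<in>carrier G. \<exists>W\<in>F. \<exists>u\<in>U. \<forall>w\<in>W. x \<otimes> u \<otimes> w \<in> D m)" for U F
  have narrowE: "\<exists>C. countable C \<and> C \<subseteq> carrier G \<and> (\<forall>x\<in>carrier G. \<exists>c\<in>C. \<exists>u\<in>U. x = c \<otimes> u) \<and>
      (\<forall>x\<in>carrier G. \<exists>u\<in>U. \<exists>c\<in>C. x = u \<otimes> c)" if "U \<in> P" for U
  proof -
    have "openin T U \<and> U \<noteq> {}" using that by (auto simp: P_def)
    from narrow[unfolded omega_narrow_def, THEN spec, THEN mp, OF this]
    obtain C where C: "countable C" "C \<subseteq> carrier G" "carrier G = C <#> U" "carrier G = U <#> C"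
      by (elim exE conjE) (rule that)
    have "\<exists>c\<in>C. \<exists>u\<in>U. x = c \<otimes> u" if "x \<in> carrier G" for x
      using that unfolding C(3) set_mult_def by simp
    moreover have "\<exists>u\<in>U. \<exists>c\<in>C. x = u \<otimes> c" if "x \<in> carrier G" for x
      using that unfolding C(4) set_mult_def by simp
    ultimately show ?thesis using C(1,2) by (intro exI[of _ C]) simp
  qed
  have ex: "\<exists>F. countable F \<and> F \<subseteq> P \<and> Q U F" if "U \<in> P" for U
  proof -
    have U: "openin T U" "\<one> \<in> U" using that by (auto simp: P_def)
    obtain V1 where V1: "openin T V1" "\<one> \<in> V1" "\<And>x. x \<in> V1 \<Longrightarrow> inv x \<in> V1"
      "\<And>x y. x \<in> V1 \<Longrightarrow> y \<in> V1 \<Longrightarrow> x \<otimes> y \<in> U" using sym_nbhd[OF U] by blast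
    obtain V where V: "openin T V" "\<one> \<in> V" "\<And>x. x \<in> V \<Longrightarrow> inv x \<in> V"
      "\<And>x y. x \<in> V \<Longrightarrow> y \<in> V \<Longrightarrow> x \<otimes> y \<in> V1" using sym_nbhd[OF V1(1,2)] by blast
    have Vc: "x \<in> V \<Longrightarrow> x \<in> carrier G" for x using openin_carrier V(1) by blast
    have VV1: "x \<in> V \<Longrightarrow> x \<in> V1" for x using V(4)[of x \<one>] V(2) Vc by simp
    have "closedin T (topspace T - V1)" "\<one> \<in> topspace T - (topspace T - V1)"
      using V1(1,2) openin_carrier[OF V1(1,2)] by (auto simp: topspace[symmetric])
    then obtain V2 where V2: "openin T V2" "\<one> \<in> V2" "disjnt (topspace T - V1) (T closure_of V2)"
      using reg unfolding regular_space by blast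
    have "T closure_of V2 \<subseteq> V1"
      using V2(3) closure_of_subset_topspace[of T V2] unfolding disjnt_def by blast
    moreover have V1U: "x \<in> V1 \<Longrightarrow> x \<in> U" for x using V1(4)[of x \<one>] V1(1,2) openin_carrier by fastforce
    ultimately have cl: "T closure_of (V1 \<inter> V2) \<subseteq> U"
      using closure_of_mono[of "V1 \<inter> V2" V2 T] by blast
    obtain B where B: "countable B" "B \<subseteq> carrier G" "\<And>x. x \<in> carrier G \<Longrightarrow> \<exists>c\<in>B. \<exists>u\<in>V. x = c \<otimes> u"
      "\<And>x. x \<in> carrier G \<Longrightarrow> \<exists>u\<in>V. \<exists>c\<in>B. x = u \<otimes> c"
      using narrowE[of V] V(1,2) unfolding P_def by blast
    \<comment> \<open>Conjugation by \<open>c\<close> maps \<open>N c\<close> into \<open>V\<close>.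
      Writing \<open>x = a \<otimes> c\<close> with \<open>a\<close> in \<open>V\<close>, the
      remaining conjugation by \<open>a\<close> maps \<open>V\<close> into \<open>U\<close>, so
      countably many \<open>N c\<close> serve all \<open>x\<close>.\<close>
    define N where "N c = {y \<in> carrier G. y \<otimes> inv c \<in> {z \<in> carrier G. c \<otimes> z \<in> V}}" for c
    have N: "N c \<in> P" if "c \<in> B" for c
    proof -
      have cG: "c \<in> carrier G" using that B(2) by blast
      then have "openin T (N c)"
        unfolding N_def by (intro openin_translate V(1)) simp_all
      moreover have "\<one> \<in> N c" using cG V(2) by (simp add: N_def)
      ultimately show ?thesis by (simp add: P_def)
    qed
    \<comment> \<open>Density lets \<open>D m\<close> meet the translate of \<open>V\<close> by
      \<open>c\<close> in a point \<open>c \<otimes> v\<close>, and openness of \<open>D m\<close>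
      leaves room for \<open>W\<close>.\<close>
    have "\<exists>W v. W \<in> P \<and> v \<in> V \<and> (\<forall>w\<in>W. c \<otimes> v \<otimes> w \<in> D m)" if c: "c \<in> B" for c m
    proof -
      have cG: "c \<in> carrier G" using c B(2) by blast
      have "openin T {y \<in> carrier G. inv c \<otimes> y \<in> V}" using V(1) cG by (simp add: openin_translate)
      moreover have "c \<in> {y \<in> carrier G. inv c \<otimes> y \<in> V}" using V(2) cG by simp
      ultimately have "D m \<inter> {y \<in> carrier G. inv c \<otimes> y \<in> V} \<noteq> {}"
        using D[of m] unfolding dense_open_def by (metis empty_iff)
      then obtain y where y: "y \<in> D m" "y \<in> carrier G" "inv c \<otimes> y \<in> V" by auto
      let ?W = "{w \<in> carrier G. y \<otimes> w \<in> D m}"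
      have "?W \<in> P" using y D[of m] by (auto simp: P_def dense_open_def intro: openin_translate)
      moreover have "c \<otimes> (inv c \<otimes> y) = y" using y cG by (simp add: inv_cancel)
      ultimately show ?thesis using y(3) by (intro exI[of _ ?W] exI[of _ "inv c \<otimes> y"]) auto
    qed
    then obtain W v where Wv: "\<And>c m. c \<in> B \<Longrightarrow> W c m \<in> P \<and> v c m \<in> V \<and> (\<forall>w\<in>W c m. c \<otimes> v c m \<otimes> w \<in> D m)"
      by metis
    define F where "F = insert (V1 \<inter> V2) (N ` B \<union> (\<lambda>(c, m). W c m) ` (B \<times> UNIV))"
    have "countable F" unfolding F_def using B(1) by simp
    moreover have "F \<subseteq> P" unfolding F_def using N Wv V1 V2 by (auto simp: P_def)
    moreover have "Q U F"
      unfolding Q_def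
    proof (intro conjI ballI allI)
      show "\<exists>V\<in>F. T closure_of V \<subseteq> U \<and> (\<forall>x\<in>V. \<forall>y\<in>V. x \<otimes> y \<in> U \<and> inv x \<otimes> y \<in> U)"
        using cl V1(3,4) by (intro bexI[of _ "V1 \<inter> V2"]) (auto simp: F_def)
    next
      fix x assume x: "x \<in> carrier G"
      then obtain a c where ac: "a \<in> V" "c \<in> B" "x = a \<otimes> c" using B(4) by blast
      have cG: "c \<in> carrier G" "a \<in> carrier G" using ac B(2) Vc by auto
      have "x \<otimes> w \<otimes> inv x \<in> U" if "w \<in> N c" for w
      proof -
        have w: "w \<in> carrier G" "c \<otimes> (w \<otimes> inv c) \<in> V" using that by (simp_all add: N_def)
        then have "(a \<otimes> (c \<otimes> (w \<otimes> inv c))) \<otimes> inv a \<in> U"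
          using V V1 ac(1) VV1 by simp
        then show ?thesis using w cG unfolding ac(3) by (simp add: m_assoc inv_mult_group)
      qed
      moreover have "N c \<in> F" using ac(2) by (auto simp: F_def)
      ultimately show "\<exists>V\<in>F. \<forall>v\<in>V. x \<otimes> v \<otimes> inv x \<in> U" by blast
    next
      fix m x assume x: "x \<in> carrier G"
      then obtain c a where ac: "a \<in> V" "c \<in> B" "x = c \<otimes> a" using B(3) by blast
      have cG: "c \<in> carrier G" "a \<in> carrier G" using ac B(2) Vc by auto
      have vV: "v c m \<in> V" using Wv ac(2) by blast
      \<comment> \<open>The witness \<open>u = inv a \<otimes> v c m\<close> sends
        \<open>x = c \<otimes> a\<close> to \<open>c \<otimes> v c m\<close>, so the countably many
        sets \<open>W c m\<close> serve every \<open>x\<close>.\<close>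
      have "inv a \<otimes> v c m \<in> U" using V(3,4) V1U ac(1) vV by blast
      moreover have "x \<otimes> (inv a \<otimes> v c m) \<otimes> w \<in> D m" if w: "w \<in> W c m" for w
      proof -
        have "x \<otimes> (inv a \<otimes> v c m) = c \<otimes> v c m"
          using cG Vc[OF vV] unfolding ac(3) by (simp add: m_assoc inv_cancel)
        then show ?thesis using Wv[OF ac(2)] w by simp
      qed
      moreover have "W c m \<in> F" using ac(2) unfolding F_def by blast
      ultimately show "\<exists>W\<in>F. \<exists>u\<in>U. \<forall>w\<in>W. x \<otimes> u \<otimes> w \<in> D m" by blast
    qed
    ultimately show ?thesis by blast
  qed
  have "\<exists>U. U \<in> \<C> n \<and> U \<in> P" for n
  proof -
    have "\<one> \<in> \<Union>(\<C> n)" "\<forall>U\<in>\<C> n. openin T U" using C unfolding complete_seq_def by (auto simp: topspace)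
    then show ?thesis unfolding P_def by blast
  qed
  then obtain c where c: "\<And>n. c n \<in> \<C> n" "\<And>n. c n \<in> P" by metis
  have "\<exists>\<U>. countable \<U> \<and> range c \<subseteq> \<U> \<and> \<U> \<subseteq> P \<and> (\<forall>U\<in>\<U>. Q U \<U>) \<and> (\<forall>U\<in>\<U>. \<forall>V\<in>\<U>. U \<inter> V \<in> \<U>)"
  proof (rule countable_closing_off)
    show "range c \<subseteq> P" using c(2) by blast
    show "Q U F" if "Q U E" "E \<subseteq> F" for U E F
      using that(1) subsetD[OF that(2)] unfolding Q_def by meson
  qed (use ex in \<open>auto simp: P_def openin_Int\<close>)
  then obtain \<U> where \<U>: "countable \<U>" "range c \<subseteq> \<U>" "\<U> \<subseteq> P" "\<And>U. U \<in> \<U> \<Longrightarrow> Q U \<U>"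
    "\<And>U V. U \<in> \<U> \<Longrightarrow> V \<in> \<U> \<Longrightarrow> U \<inter> V \<in> \<U>" by blast
  have c\<U>: "c n \<in> \<U>" for n using \<U>(2) by blast
  have op: "openin T U" "\<one> \<in> U" if "U \<in> \<U>" for U using that \<U>(3) by (auto simp: P_def)
  have Q1: "\<exists>V\<in>\<U>. T closure_of V \<subseteq> U \<and> (\<forall>x\<in>V. \<forall>y\<in>V. x \<otimes> y \<in> U \<and> inv x \<otimes> y \<in> U)" 
   and Q2: "x \<in> carrier G \<Longrightarrow> \<exists>V\<in>\<U>. \<forall>v\<in>V. x \<otimes> v \<otimes> inv x \<in> U"
   and Q3: "x \<in> carrier G \<Longrightarrow> \<exists>W\<in>\<U>. \<exists>u\<in>U. \<forall>w\<in>W. x \<otimes> u \<otimes> w \<in> D m"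
    if "U \<in> \<U>" for U x m
    using \<U>(4)[OF that] unfolding Q_def by simp_all
  define K where "K = \<Inter>\<U>"
  have KU: "k \<in> U" if "k \<in> K" "U \<in> \<U>" for k U using that by (simp add: K_def)
  have Kc: "k \<in> carrier G" if "k \<in> K" for k using KU[OF that c\<U>[of 0]] op(1)[OF c\<U>] openin_carrier by blast
  have K1: "\<one> \<in> K" using op(2) by (simp add: K_def)
  have Kmult: "x \<otimes> y \<in> K" "inv x \<otimes> y \<in> K" if "x \<in> K" "y \<in> K" for x y
  proof -
    have "x \<otimes> y \<in> U \<and> inv x \<otimes> y \<in> U" if "U \<in> \<U>" for U
      using Q1[OF that] KU[OF \<open>x \<in> K\<close>] KU[OF \<open>y \<in> K\<close>] by blast
    then show "x \<otimes> y \<in> K" "inv x \<otimes> y \<in> K" by (simp_all add: K_def)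
  qed
  have Kinv: "inv x \<in> K" if "x \<in> K" for x using Kmult(2)[OF that K1] Kc[OF that] by simp
  have sub: "subgroup K G"
    by (rule subgroupI) (use Kc K1 Kinv Kmult in auto)
  have normal: "x \<otimes> k \<otimes> inv x \<in> K" if "x \<in> carrier G" "k \<in> K" for x k
  proof -
    have "x \<otimes> k \<otimes> inv x \<in> U" if "U \<in> \<U>" for U
      using Q2[OF that \<open>x \<in> carrier G\<close>] KU[OF \<open>k \<in> K\<close>] by blast
    then show ?thesis by (simp add: K_def)
  qed
  \<comment> \<open>This takes the place of compactness of \<open>K\<close>. If no member fits into
    \<open>V\<close>, the sets \<open>T closure_of U - V\<close> form a filter base, small because
    the family contains the \<open>c n\<close>; its common point would lie in \<open>K\<close> but
    not in \<open>V\<close>.\<close>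
  have base: "\<exists>U\<in>\<U>. U \<subseteq> V" if V: "openin T V" "K \<subseteq> V" for V
  proof (rule ccontr)
    assume no: "\<not> ?thesis"
    define \<F> where "\<F> = (\<lambda>U. T closure_of U - V) ` \<U>"
    have "\<forall>F\<in>\<F>. closedin T F \<and> F \<noteq> {}"
    proof
      fix F assume "F \<in> \<F>"
      then obtain U where U: "U \<in> \<U>" "F = T closure_of U - V" by (auto simp: \<F>_def)
      have "U \<subseteq> T closure_of U" by (intro closure_of_subset openin_subset op U)
      then show "closedin T F \<and> F \<noteq> {}" using no U V(1) by (auto intro: closedin_diff)
    qed
    moreover have "\<forall>E\<in>\<F>. \<forall>F\<in>\<F>. \<exists>D\<in>\<F>. D \<subseteq> E \<inter> F"
    proof (intro ballI)
      fix E F assume "E \<in> \<F>" "F \<in> \<F>"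
      then obtain U1 U2 where U: "U1 \<in> \<U>" "E = T closure_of U1 - V" "U2 \<in> \<U>" "F = T closure_of U2 - V"
        by (auto simp: \<F>_def)
      have "T closure_of (U1 \<inter> U2) - V \<in> \<F>" using \<U>(5) U by (simp add: \<F>_def)
      moreover have "T closure_of (U1 \<inter> U2) - V \<subseteq> E \<inter> F"
        unfolding U using closure_of_mono[of "U1 \<inter> U2" U1 T] closure_of_mono[of "U1 \<inter> U2" U2 T] by blast
      ultimately show "\<exists>D\<in>\<F>. D \<subseteq> E \<inter> F" by blast
    qed
    moreover have "\<forall>n. \<exists>F\<in>\<F>. \<exists>U\<in>\<C> n. F \<subseteq> U"
    proof
      fix n
      obtain U where "U \<in> \<U>" "T closure_of U \<subseteq> c n" using Q1[OF c\<U>[of n]] by blast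
      then have "T closure_of U - V \<in> \<F>" "T closure_of U - V \<subseteq> c n" by (auto simp: \<F>_def)
      then show "\<exists>F\<in>\<F>. \<exists>U\<in>\<C> n. F \<subseteq> U" using c(1)[of n] by (intro bexI)
    qed
    ultimately have "\<Inter>\<F> \<noteq> {}"
      using conjunct2[OF C[unfolded complete_seq_def], THEN spec, THEN mp] by simp
    then obtain x where x: "x \<in> \<Inter>\<F>" by (auto simp only: ex_in_conv[symmetric])
    then have xU: "x \<in> T closure_of U" "x \<notin> V" if "U \<in> \<U>" for U
      using InterD[OF x, of "T closure_of U - V"] that by (simp_all add: \<F>_def)
    have "x \<in> U" if "U \<in> \<U>" for U using Q1[OF that] xU(1) by blast
    then have "x \<in> K" by (simp add: K_def)
    then show False using xU(2)[OF c\<U>[of 0]] V(2) by blast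
  qed
  define DK where "DK m = {x \<in> carrier G. \<forall>k\<in>K. x \<otimes> k \<in> D m}" for m
  have "dense_open T (DK m)" for m
    unfolding dense_open_def
  proof (intro conjI allI impI)
    have Dm: "openin T (D m)" using D[of m] by (simp add: dense_open_def)
    \<comment> \<open>By \<open>base\<close>, a whole translate of some \<open>U\<close> by
      \<open>x\<close> lies in \<open>D m\<close>; with products of \<open>V\<close> inside
      \<open>U\<close>, the translate of \<open>V\<close> by \<open>x\<close> stays in the
      core.\<close>
    show "openin T (DK m)"
    proof (subst openin_subopen, intro ballI)
      fix x assume x: "x \<in> DK m"
      then have xG: "x \<in> carrier G" by (simp add: DK_def)
      have "K \<subseteq> {z \<in> carrier G. x \<otimes> z \<in> D m}" using x Kc by (auto simp: DK_def)
      then obtain U where U: "U \<in> \<U>" "U \<subseteq> {z \<in> carrier G. x \<otimes> z \<in> D m}"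
        using base openin_translate(1)[OF xG Dm] by blast
      obtain V where V: "V \<in> \<U>" "\<And>y z. y \<in> V \<Longrightarrow> z \<in> V \<Longrightarrow> y \<otimes> z \<in> U" using Q1[OF U(1)] by blast
      let ?N = "{y \<in> carrier G. inv x \<otimes> y \<in> V}"
      have "openin T ?N" using openin_translate(1)[of "inv x" V] xG op(1)[OF V(1)] by simp
      moreover have "x \<in> ?N" using xG op(2)[OF V(1)] by simp
      moreover have "?N \<subseteq> DK m"
      proof
        fix y assume y: "y \<in> ?N"
        have "y \<otimes> k \<in> D m" if k: "k \<in> K" for k
        proof -
          have "(inv x \<otimes> y) \<otimes> k \<in> U" using V(2) y KU[OF k V(1)] by simp
          then have "x \<otimes> ((inv x \<otimes> y) \<otimes> k) \<in> D m" using U(2) by blast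
          then show ?thesis using xG y Kc[OF k] by (simp add: m_assoc inv_cancel)
        qed
        then show "y \<in> DK m" using y by (simp add: DK_def)
      qed
      ultimately show "\<exists>S. openin T S \<and> x \<in> S \<and> S \<subseteq> DK m" by blast
    qed
    fix V assume V: "openin T V \<and> V \<noteq> {}"
    then obtain x where x: "x \<in> V" by blast
    have xG: "x \<in> carrier G" using openin_carrier V x by blast
    \<comment> \<open>\<open>V1\<close> is the saturation of \<open>V\<close> under
      \<open>K\<close>. The third clause of \<open>Q\<close> finds a point
      \<open>x \<otimes> u\<close> of \<open>V1\<close> whose translate of \<open>W\<close> lies in
      \<open>D m\<close>; moving it by an element of \<open>K\<close> into \<open>V\<close>
      preserves membership in the core, since \<open>K\<close> lies in \<open>W\<close>.\<close>
    define V1 where "V1 = (\<Union>k\<in>K. {y \<in> carrier G. y \<otimes> k \<in> V})"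
    have V1op: "openin T V1" unfolding V1_def using Kc V by (intro openin_Union) (auto intro!: openin_translate)
    have "x \<otimes> k \<in> V1" if k: "k \<in> K" for k
    proof -
      have "x \<otimes> k \<otimes> inv k \<in> V" using x xG Kc[OF k] by (simp add: m_assoc)
      then show ?thesis unfolding V1_def using Kinv[OF k] xG Kc[OF k] by blast
    qed
    then have "K \<subseteq> {z \<in> carrier G. x \<otimes> z \<in> V1}" using Kc by auto
    then obtain U where U: "U \<in> \<U>" "U \<subseteq> {z \<in> carrier G. x \<otimes> z \<in> V1}"
      using base openin_translate(1)[OF xG V1op] by blast
    obtain W u where Wu: "W \<in> \<U>" "u \<in> U" "\<And>w. w \<in> W \<Longrightarrow> x \<otimes> u \<otimes> w \<in> D m"
      using Q3[OF U(1) xG, of m] by blast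
    have "x \<otimes> u \<in> V1" and uG: "u \<in> carrier G" using U(2) Wu(2) by auto
    then obtain k where k: "k \<in> K" "x \<otimes> u \<otimes> k \<in> V" unfolding V1_def by blast
    have "x \<otimes> u \<otimes> k \<otimes> k' \<in> D m" if k': "k' \<in> K" for k'
      using Wu(3)[OF KU[OF Kmult(1)[OF k(1) k'] Wu(1)]] xG uG Kc[OF k(1)] Kc[OF k'] by (simp add: m_assoc)
    then have "x \<otimes> u \<otimes> k \<in> DK m" using xG uG Kc[OF k(1)] by (simp add: DK_def)
    then show "DK m \<inter> V \<noteq> {}" using k(2) by blast
  qed
  moreover have "\<exists>\<phi> :: 'a \<Rightarrow> nat \<Rightarrow> bool. \<forall>x\<in>carrier G. \<forall>y\<in>carrier G. \<phi> x = \<phi> y \<longrightarrow> inv x \<otimes> y \<in> K"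
  proof -
    obtain B where B: "\<And>U. U \<in> \<U> \<Longrightarrow> countable (B U) \<and> B U \<subseteq> carrier G \<and> (\<forall>x\<in>carrier G. \<exists>c\<in>B U. \<exists>u\<in>U. x = c \<otimes> u)"
      using narrowE subsetD[OF \<U>(3)] by metis
    define Z where "Z = (SIGMA U:\<U>. B U)"
    have "countable Z" unfolding Z_def using \<U>(1) B by (intro countable_SIGMA) auto
    \<comment> \<open>The code records which of countably many translates of members of the family
      contain \<open>x\<close>. Every member \<open>U\<close> has a \<open>V\<close> for which a
      shared translate forces \<open>inv x \<otimes> y\<close> into \<open>U\<close>.\<close>
    define \<phi> where "\<phi> x n = (case from_nat_into Z n of (U, c) \<Rightarrow> inv c \<otimes> x \<in> U)" for x n
    have "inv x \<otimes> y \<in> K" if xy: "x \<in> carrier G" "y \<in> carrier G" "\<phi> x = \<phi> y" for x y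
    proof -
      have "inv x \<otimes> y \<in> U" if U: "U \<in> \<U>" for U
      proof -
        obtain V where V: "V \<in> \<U>" "\<And>y z. y \<in> V \<Longrightarrow> z \<in> V \<Longrightarrow> inv y \<otimes> z \<in> U" using Q1[OF U] by blast
        obtain c v where cv: "c \<in> B V" "v \<in> V" "x = c \<otimes> v" using B[OF V(1)] xy(1) by blast
        have cG: "c \<in> carrier G" "v \<in> carrier G"
          using B[OF V(1)] cv openin_carrier[OF op(1)[OF V(1)]] by auto
        have "(V, c) \<in> Z" using V(1) cv(1) by (simp add: Z_def)
        then obtain n where n: "from_nat_into Z n = (V, c)"
          using from_nat_into_surj[OF \<open>countable Z\<close>] by metis
        have "inv c \<otimes> x \<in> V" using cv cG by (simp add: inv_cancel)
        moreover have "\<phi> x n = \<phi> y n" using xy(3) by simp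
        ultimately have "inv c \<otimes> y \<in> V" by (simp add: \<phi>_def n)
        then have "inv (inv c \<otimes> x) \<otimes> (inv c \<otimes> y) \<in> U" using V(2) \<open>inv c \<otimes> x \<in> V\<close> by blast
        then show ?thesis using xy cG by (simp add: inv_mult_group m_assoc inv_cancel)
      qed
      then show ?thesis by (simp add: K_def)
    qed
    then show ?thesis by blast
  qed
  ultimately show ?thesis using that[OF sub normal] unfolding DK_def by blast
qed

section \<open>Preimages of identity neighbourhoods are nonmeager\<close>

text \<open>A meager preimage stays meager after multiplication by the subgroup from
  \<open>invariant_kernel\<close>. Then closeness modulo that subgroup has meager balls and a code
  by the Cantor space, which \<open>no_meager_entourage\<close> excludes.\<close>

lemma hom_preimage_not_meager:
  assumes narrow: "omega_narrow G T" and C: "complete_seq T \<C>" and reg: "regular_space T"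
    and H: "topgroup H T'" and h: "h \<in> hom G H" and bp: "BP_measurable T T' h"
    and W: "openin T' W" "\<one>\<^bsub>H\<^esub> \<in> W"
  shows "\<not> meager_in T {x \<in> carrier G. h x \<in> W}"
proof
  interpret H: topgroup H T' by (rule H)
  interpret h: group_hom G H h by unfold_locales (rule h)
  assume "meager_in T {x \<in> carrier G. h x \<in> W}"
  then obtain D where D: "\<And>n::nat. dense_open T (D n)" "{x \<in> carrier G. h x \<in> W} \<inter> (\<Inter>n. D n) = {}"
    using meager_inE by blast
  obtain K and \<phi> :: "'a \<Rightarrow> nat \<Rightarrow> bool" where K: "subgroup K G"
    and normal: "\<And>x k. x \<in> carrier G \<Longrightarrow> k \<in> K \<Longrightarrow> x \<otimes> k \<otimes> inv x \<in> K"
    and DK: "\<And>m. dense_open T {x \<in> carrier G. \<forall>k\<in>K. x \<otimes> k \<in> D m}"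
    and \<phi>: "\<And>x y. x \<in> carrier G \<Longrightarrow> y \<in> carrier G \<Longrightarrow> \<phi> x = \<phi> y \<Longrightarrow> inv x \<otimes> y \<in> K"
    using invariant_kernel[OF narrow C reg, of D] D(1) by blast
  interpret K: subgroup K G by (rule K)
  define s where "s U = (SOME V. openin T' V \<and> \<one>\<^bsub>H\<^esub> \<in> V \<and> (\<forall>x\<in>V. inv\<^bsub>H\<^esub> x \<in> V) \<and>
     (\<forall>x\<in>V. \<forall>y\<in>V. x \<otimes>\<^bsub>H\<^esub> y \<in> U))" for U
  have s: "openin T' (s U) \<and> \<one>\<^bsub>H\<^esub> \<in> s U \<and> (\<forall>x\<in>s U. inv\<^bsub>H\<^esub> x \<in> s U) \<and>
     (\<forall>x\<in>s U. \<forall>y\<in>s U. x \<otimes>\<^bsub>H\<^esub> y \<in> U)" if U: "openin T' U" "\<one>\<^bsub>H\<^esub> \<in> U" for U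
  proof -
    have "\<exists>V. openin T' V \<and> \<one>\<^bsub>H\<^esub> \<in> V \<and> (\<forall>x\<in>V. inv\<^bsub>H\<^esub> x \<in> V) \<and> (\<forall>x\<in>V. \<forall>y\<in>V. x \<otimes>\<^bsub>H\<^esub> y \<in> U)"
      by (rule H.sym_nbhd[OF U]) auto
    then show ?thesis unfolding s_def by (rule someI_ex)
  qed
  \<comment> \<open>Starting with \<open>s W\<close> instead of \<open>W\<close> makes
    \<open>w 0\<close> symmetric as well.\<close>
  define w where "w n = (s ^^ Suc n) W" for n
  have w0: "w 0 = s W" and wS: "w (Suc n) = s (w n)" for n by (simp_all add: w_def)
  have w: "openin T' (w n) \<and> \<one>\<^bsub>H\<^esub> \<in> w n \<and> (\<forall>x\<in>w n. inv\<^bsub>H\<^esub> x \<in> w n)" for n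
  proof (induction n)
    case 0 then show ?case using s[OF W] by (simp add: w0)
  next
    case (Suc n) then show ?case using s[of "w n"] by (simp add: wS)
  qed
  have wmult: "x \<otimes>\<^bsub>H\<^esub> y \<in> w n" if "x \<in> w (Suc n)" "y \<in> w (Suc n)" for x y n
    using s[of "w n"] w[of n] that by (simp add: wS)
  have w0W: "w 0 \<subseteq> W"
  proof
    fix x assume x: "x \<in> w 0"
    then have "x \<otimes>\<^bsub>H\<^esub> \<one>\<^bsub>H\<^esub> \<in> W" using s[OF W] by (simp add: w0)
    moreover have "x \<in> carrier H" using H.openin_carrier[of "w 0" x] w[of 0] x by simp
    ultimately show "x \<in> W" by simp
  qed
  define AK where "AK = {a \<otimes> k | a k. a \<in> carrier G \<and> h a \<in> W \<and> k \<in> K}"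
  have AK: "meager_in T AK"
    unfolding meager_in_iff
  proof (intro conjI exI[of _ "\<lambda>m. {x \<in> carrier G. \<forall>k\<in>K. x \<otimes> k \<in> D m}"] allI)
    show "AK \<subseteq> topspace T" by (auto simp: AK_def topspace)
    show "dense_open T {x \<in> carrier G. \<forall>k\<in>K. x \<otimes> k \<in> D m}" for m by (rule DK)
    show "AK \<inter> (\<Inter>m. {x \<in> carrier G. \<forall>k\<in>K. x \<otimes> k \<in> D m}) = {}"
    proof (rule equals0I)
      fix x assume x: "x \<in> AK \<inter> (\<Inter>m. {x \<in> carrier G. \<forall>k\<in>K. x \<otimes> k \<in> D m})"
      then obtain a k where a: "a \<in> carrier G" "h a \<in> W" "k \<in> K" "x = a \<otimes> k" by (auto simp: AK_def)
      have "x \<otimes> inv k \<in> D m" for m using x K.m_inv_closed[OF a(3)] by simp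
      moreover have "x \<otimes> inv k = a" using a K.subset by (simp add: m_assoc)
      ultimately show False using D(2) a(1,2) by auto
    qed
  qed
  \<comment> \<open>Closeness of \<open>h x\<close> and \<open>h y\<close> modulo \<open>h ` K\<close>, so that points of the same K-coset are indistinguishable.\<close>
  define R where "R n x y \<longleftrightarrow> x \<in> carrier G \<and> y \<in> carrier G \<and> (\<exists>k\<in>K. h (y \<otimes> k \<otimes> inv x) \<in> w n)" for n x y
  show False
  proof (rule no_meager_entourage[OF C reg, of R \<phi>])
    show "topspace T \<noteq> {}" using topspace by blast
    show "x \<in> topspace T \<and> y \<in> topspace T" if "R n x y" for n x y using that by (simp add: R_def topspace)
    show "R n x x" if "x \<in> topspace T" for n x
      using that w[of n] unfolding R_def by (auto simp: topspace intro!: bexI[of _ \<one>])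
    show "R n y x" if "R n x y" for n x y
    proof -
      obtain k where k: "x \<in> carrier G" "y \<in> carrier G" "k \<in> K" "h (y \<otimes> k \<otimes> inv x) \<in> w n"
        using \<open>R n x y\<close> unfolding R_def by blast
      have kG: "k \<in> carrier G" using k(3) by simp
      have "x \<otimes> inv k \<otimes> inv y = inv (y \<otimes> k \<otimes> inv x)"
        using k(1,2) kG by (simp add: inv_mult_group m_assoc)
      then have "h (x \<otimes> inv k \<otimes> inv y) = inv\<^bsub>H\<^esub> h (y \<otimes> k \<otimes> inv x)"
        using k(1,2) kG by (simp only: h.hom_inv m_closed inv_closed)
      then have "h (x \<otimes> inv k \<otimes> inv y) \<in> w n" using w[of n] k(4) by simp
      then show ?thesis unfolding R_def using k K.m_inv_closed[OF k(3)] by blast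
    qed
    show "R n x z" if R: "R (Suc n) x y" "R (Suc n) y z" for n x y z
    proof -
      obtain k where k: "x \<in> carrier G" "y \<in> carrier G" "k \<in> K" "h (y \<otimes> k \<otimes> inv x) \<in> w (Suc n)"
        using R(1) unfolding R_def by blast
      obtain l where l: "z \<in> carrier G" "l \<in> K" "h (z \<otimes> l \<otimes> inv y) \<in> w (Suc n)"
        using R(2) unfolding R_def by blast
      have kG: "k \<in> carrier G" "l \<in> carrier G" using k(3) l(2) by simp_all
      have "z \<otimes> (l \<otimes> k) \<otimes> inv x = (z \<otimes> l \<otimes> inv y) \<otimes> (y \<otimes> k \<otimes> inv x)"
        using k(1,2) l(1) kG by (simp add: m_assoc inv_cancel)
      then have "h (z \<otimes> (l \<otimes> k) \<otimes> inv x) = h (z \<otimes> l \<otimes> inv y) \<otimes>\<^bsub>H\<^esub> h (y \<otimes> k \<otimes> inv x)"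
        using k(1,2) l(1) kG by (simp only: h.hom_mult m_closed inv_closed)
      then have "h (z \<otimes> (l \<otimes> k) \<otimes> inv x) \<in> w n" using wmult[OF l(3) k(4)] by simp
      then show ?thesis unfolding R_def using k(1) l(1) K.m_closed[OF l(2) k(3)] by blast
    qed
    show "{y. \<exists>x\<in>S. R n x y} \<in> baire_property_sets T" for n S
    proof -
      \<comment> \<open>Being related to a point of \<open>S\<close> is a condition on
        \<open>h y\<close> alone, and it is open because it is a union of translates of
        \<open>w n\<close>. So \<open>S\<close> may be arbitrary.\<close>
      define U where "U = (\<Union>x\<in>S \<inter> carrier G. \<Union>k\<in>K. {z \<in> carrier H. z \<otimes>\<^bsub>H\<^esub> h (k \<otimes> inv x) \<in> w n})"
      have "openin T' U"
        unfolding U_def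
      proof (intro openin_Union ballI; elim imageE; hypsubst)
        fix x assume x: "x \<in> S \<inter> carrier G"
        show "openin T' (\<Union>k\<in>K. {z \<in> carrier H. z \<otimes>\<^bsub>H\<^esub> h (k \<otimes> inv x) \<in> w n})"
        proof (intro openin_Union ballI; elim imageE; hypsubst)
          fix k assume "k \<in> K"
          then show "openin T' {z \<in> carrier H. z \<otimes>\<^bsub>H\<^esub> h (k \<otimes> inv x) \<in> w n}"
            using x w[of n] by (intro H.openin_translate) simp_all
        qed
      qed
      then have "{y \<in> topspace T. h y \<in> U} \<in> baire_property_sets T"
        using bp unfolding BP_measurable_def by simp
      moreover have R: "R n x y \<longleftrightarrow> x \<in> carrier G \<and> y \<in> carrier G \<and> (\<exists>k\<in>K. h y \<otimes>\<^bsub>H\<^esub> h (k \<otimes> inv x) \<in> w n)" for x y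
      proof (cases "x \<in> carrier G \<and> y \<in> carrier G")
        case True
        then have "h (y \<otimes> k \<otimes> inv x) = h y \<otimes>\<^bsub>H\<^esub> h (k \<otimes> inv x)" if "k \<in> K" for k
          using that by (simp add: m_assoc)
        then show ?thesis unfolding R_def by (simp cong: bex_cong)
      next
        case False then show ?thesis unfolding R_def by argo
      qed
      have mem: "h y \<in> U \<longleftrightarrow> (\<exists>x\<in>S. x \<in> carrier G \<and> (\<exists>k\<in>K. h y \<otimes>\<^bsub>H\<^esub> h (k \<otimes> inv x) \<in> w n))"
        if "y \<in> carrier G" for y
        unfolding U_def using h.hom_closed[OF that] by blast
      have "{y. \<exists>x\<in>S. R n x y} = {y \<in> topspace T. h y \<in> U}"
      proof (rule Set.set_eqI)
        show "y \<in> {y. \<exists>x\<in>S. R n x y} \<longleftrightarrow> y \<in> {y \<in> topspace T. h y \<in> U}" for y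
          using mem[of y] unfolding mem_Collect_eq topspace R by blast
      qed
      ultimately show ?thesis by simp
    qed
    show "meager_in T {y. R 0 x y}" for x
    proof (cases "x \<in> carrier G")
      case True
      \<comment> \<open>From \<open>a = y \<otimes> k \<otimes> inv x\<close> one gets
        \<open>y = a \<otimes> x \<otimes> inv k\<close>; normality moves the element of
        \<open>K\<close> to the left of \<open>x\<close>, so the ball sits in a right translate of
        \<open>AK\<close>.\<close>
      have "{y. R 0 x y} \<subseteq> (\<lambda>z. z \<otimes> x) ` AK"
      proof
        fix y assume "y \<in> {y. R 0 x y}"
        then obtain k where k: "y \<in> carrier G" "k \<in> K" "h (y \<otimes> k \<otimes> inv x) \<in> w 0"
          unfolding R_def by blast
        define a where "a = y \<otimes> k \<otimes> inv x"
        have kG: "k \<in> carrier G" using k(2) by simp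
        then have a: "a \<in> carrier G" "h a \<in> W" using k True w0W by (auto simp: a_def)
        have "y = (a \<otimes> (x \<otimes> inv k \<otimes> inv x)) \<otimes> x"
          using k(1) True kG by (simp add: a_def m_assoc inv_cancel)
        moreover have "a \<otimes> (x \<otimes> inv k \<otimes> inv x) \<in> AK"
          unfolding AK_def using a normal[OF True K.m_inv_closed[OF k(2)]] by blast
        ultimately show "y \<in> (\<lambda>z. z \<otimes> x) ` AK" by (rule image_eqI)
      qed
      with meager_in_translate[OF True AK] show ?thesis by (rule meager_in_subset)
    next
      case False
      then have "{y. R 0 x y} = {}" unfolding R_def by simp
      then show ?thesis by (simp only: meager_in_empty)
    qed
    show "R n x y" if xy: "x \<in> topspace T" "y \<in> topspace T" "\<phi> x = \<phi> y" for n x y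
    proof -
      have G: "x \<in> carrier G" "y \<in> carrier G" using xy by (simp_all add: topspace)
      \<comment> \<open>The choice \<open>k = inv (inv x \<otimes> y)\<close> makes
        \<open>y \<otimes> k \<otimes> inv x\<close> the identity, which works at every
        level.\<close>
      have "inv (inv x \<otimes> y) \<in> K" using K.m_inv_closed[OF \<phi>[OF G xy(3)]] .
      moreover have e: "y \<otimes> inv (inv x \<otimes> y) \<otimes> inv x = \<one>"
        using G by (simp add: inv_mult_group m_assoc inv_cancel)
      have "h (y \<otimes> inv (inv x \<otimes> y) \<otimes> inv x) \<in> w n" unfolding e h.hom_one using w[of n] by simp
      ultimately show ?thesis unfolding R_def using G by blast
    qed
  qed
qed

end

section \<open>Continuity of the homomorphism\<close>

theorem theorem1p3:
  fixes G :: "('a, 'b) monoid_scheme" and TX :: "'a topology"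
    and H :: "('c, 'd) monoid_scheme" and TY :: "'c topology"
    and h :: "'a \<Rightarrow> 'c"
  assumes "topological_group G TX"
    and "omega_narrow G TX"
    and "cech_complete TYPE('k) TX"
    and "topological_group H TY"
    and "h \<in> hom G H"
    and "BP_measurable TX TY h"
  shows "continuous_map TX TY h"
proof -
  interpret G: topgroup G TX using assms(1) by (simp add: topological_group_iff)
  interpret H: topgroup H TY using assms(4) by (simp add: topological_group_iff)
  interpret h: group_hom G H h by unfold_locales (rule assms(5))
  obtain \<C> where C: "complete_seq TX \<C>" using cech_complete_imp_complete_seq[OF assms(3)] by blast
  have reg: "regular_space TX"
    using assms(3) completely_regular_imp_regular_space by (auto simp: cech_complete_def)
  \<comment> \<open>Continuity at the identity: for a symmetric \<open>V\<close> with products in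
    \<open>W\<close>, the Pettis neighbourhood consists of quotients of points of the preimage of
    \<open>V\<close>, which \<open>h\<close> sends into \<open>W\<close>.\<close>
  have nbhd: "\<exists>N. openin TX N \<and> \<one>\<^bsub>G\<^esub> \<in> N \<and> (\<forall>y\<in>N. h y \<in> W)"
    if W: "openin TY W" "\<one>\<^bsub>H\<^esub> \<in> W" for W
  proof -
    obtain V where V: "openin TY V" "\<one>\<^bsub>H\<^esub> \<in> V" "\<And>x. x \<in> V \<Longrightarrow> inv\<^bsub>H\<^esub> x \<in> V"
      "\<And>x y. x \<in> V \<Longrightarrow> y \<in> V \<Longrightarrow> x \<otimes>\<^bsub>H\<^esub> y \<in> W" using H.sym_nbhd[OF W] by blast
    let ?A = "{x \<in> carrier G. h x \<in> V}"
    have "\<not> meager_in TX ?A"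
      by (rule G.hom_preimage_not_meager[OF assms(2) C reg _ assms(5,6) V(1,2)]) (rule H.topgroup_axioms)
    moreover have "?A \<in> baire_property_sets TX"
      using assms(6) V(1) by (simp add: BP_measurable_def G.topspace)
    ultimately obtain N where N: "openin TX N" "\<one>\<^bsub>G\<^esub> \<in> N"
      "\<And>y. y \<in> N \<Longrightarrow> \<exists>a\<in>?A. \<exists>b\<in>?A. y = inv\<^bsub>G\<^esub> b \<otimes>\<^bsub>G\<^esub> a"
      using G.Pettis[OF C reg] by blast
    have "h y \<in> W" if y: "y \<in> N" for y
    proof -
      obtain a b where ab: "a \<in> ?A" "b \<in> ?A" "y = inv\<^bsub>G\<^esub> b \<otimes>\<^bsub>G\<^esub> a" using N(3)[OF y] by blast
      then have "h y = inv\<^bsub>H\<^esub> h b \<otimes>\<^bsub>H\<^esub> h a" by simp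
      then show ?thesis using V(3,4) ab(1,2) by simp
    qed
    then show ?thesis using N(1,2) by blast
  qed
  \<comment> \<open>Continuity elsewhere follows by translating by \<open>x\<close> in the domain
    and by \<open>h x\<close> in the target.\<close>
  have "openin TX {x \<in> carrier G. h x \<in> U}" if U: "openin TY U" for U
  proof (subst openin_subopen, intro ballI)
    fix x assume x: "x \<in> {x \<in> carrier G. h x \<in> U}"
    then have xG: "x \<in> carrier G" "h x \<in> U" by simp_all
    let ?W = "{z \<in> carrier H. h x \<otimes>\<^bsub>H\<^esub> z \<in> U}"
    have "openin TY ?W" using H.openin_translate(1)[OF _ U] xG by simp
    moreover have "\<one>\<^bsub>H\<^esub> \<in> ?W" using xG by simp
    ultimately obtain N where N: "openin TX N" "\<one>\<^bsub>G\<^esub> \<in> N" "\<And>y. y \<in> N \<Longrightarrow> h y \<in> ?W"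
      using nbhd[of ?W] by blast
    let ?N = "{y \<in> carrier G. inv\<^bsub>G\<^esub> x \<otimes>\<^bsub>G\<^esub> y \<in> N}"
    have "openin TX ?N" using G.openin_translate(1)[OF _ N(1)] xG by simp
    moreover have "x \<in> ?N" using xG N(2) by simp
    moreover have "?N \<subseteq> {x \<in> carrier G. h x \<in> U}"
    proof
      fix y assume y: "y \<in> ?N"
      then have "h x \<otimes>\<^bsub>H\<^esub> h (inv\<^bsub>G\<^esub> x \<otimes>\<^bsub>G\<^esub> y) \<in> U" using N(3) by blast
      moreover have "h x \<otimes>\<^bsub>H\<^esub> h (inv\<^bsub>G\<^esub> x \<otimes>\<^bsub>G\<^esub> y) = h y"
        using y xG by (simp add: H.inv_cancel)
      ultimately show "y \<in> {x \<in> carrier G. h x \<in> U}" using y by simp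
    qed
    ultimately show "\<exists>T. openin TX T \<and> x \<in> T \<and> T \<subseteq> {x \<in> carrier G. h x \<in> U}" by blast
  qed
  moreover have "h \<in> topspace TX \<rightarrow> topspace TY" using h.hom_closed by (simp add: G.topspace H.topspace)
  ultimately show ?thesis unfolding continuous_map_def by (simp add: G.topspace)
qed

end
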